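(* Let $k$ be an algebraically closed field of characteristic $2$, let $V$ be a $3$-dimensional vector space over $k$, and let $n>1$ be an integer. Let $G$ be a finite subgroup of $\mathrm{GL}(V)$ generated by pseudoreflections each of order $2^r$ for some $r\ge 1$ (hence by transvections). Assume that $G$ has a $2$-dimensional invariant subspace $W\subset V$ and that the restriction of $G$ to $W$ is isomorphic to the group $\mathrm{SL}_2(\mathbb{F}_{2^n})$ in its natural representation. Then the ring of invariants $S(V^* )^G$ is polynomial.
   Context: A linear map $\varphi\colon V\to V$ is a pseudoreflection if the set of points fixed by $\varphi$ is a hyperplane in $V$; a pseudoreflection is a transvection if $1$ is its only eigenvalue. $S(V^* )$ is the symmetric algebra of the dual space $V^*$ (polynomial functions on $V$), with the action of $G$ induced from that on $V$; $S(V^* )^G$ is the subring of invariants. It is called polynomial if it is generated as a $k$-algebra by $\dim V$ algebraically independent homogeneous elements. $\mathbb{F}_{2^n}$ is regarded as a subfield of $k$. "The restriction of $G$ to $W$ is $\mathrm{SL}_2(\mathbb{F}_{2^n})$ in its natural representation" means that in a suitable basis of $W$ the image of $G$ in $\mathrm{GL}(W)\cong\mathrm{GL}_2(k)$ is exactly the group of $2\times 2$ matrices of determinant $1$ with entries in $\mathbb{F}_{2^n}$. *)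

theory Defs
  imports
    "HOL-Analysis.Determinants"
    "HOL-Algebra.Multiplicative_Group"
    "HOL-Algebra.Generated_Groups"
    "HOL-Algebra.Algebraic_Closure_Type"
    "HOL-Library.Function_Algebras"
    "HOL-Library.Poly_Mapping"
begin

definition SL :: "'k::field set \<Rightarrow> ('k ^ 'n ^ 'n) set" where
  "SL F = {M. det M = 1 \<and> (\<forall>i j. M $ i $ j \<in> F)}"

text \<open>The \<open>k\<close>-algebra generated by \<open>A\<close>, inside the algebra of all functions on \<open>V\<close>
  with pointwise operations.\<close>

inductive_set generated_algebra :: "('v \<Rightarrow> 'k::comm_ring_1) set \<Rightarrow> ('v \<Rightarrow> 'k) set"
  for A :: "('v \<Rightarrow> 'k) set" where
  const: "(\<lambda>_. c) \<in> generated_algebra A"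
| incl: "f \<in> A \<Longrightarrow> f \<in> generated_algebra A"
| add: "f \<in> generated_algebra A \<Longrightarrow> g \<in> generated_algebra A \<Longrightarrow> f + g \<in> generated_algebra A"
| mult: "f \<in> generated_algebra A \<Longrightarrow> g \<in> generated_algebra A \<Longrightarrow> f * g \<in> generated_algebra A"

text \<open>A polynomial in the variables \<open>X\<^sub>0, X\<^sub>1, \<dots>\<close> is a finitely supported map from monomials
  (finitely supported exponent functions) to coefficients; the next function evaluates
  such a polynomial at \<open>X\<^sub>i = f i\<close>.\<close>

definition eval_poly :: "((nat \<Rightarrow>\<^sub>0 nat) \<Rightarrow>\<^sub>0 'k::comm_ring_1) \<Rightarrow> (nat \<Rightarrow> 'v \<Rightarrow> 'k) \<Rightarrow> 'v \<Rightarrow> 'k" where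
  "eval_poly p f = (\<lambda>v. \<Sum>m\<in>Poly_Mapping.keys p.
     Poly_Mapping.lookup p m * (\<Prod>i\<in>Poly_Mapping.keys m. f i v ^ Poly_Mapping.lookup m i))"

definition algebraically_independent :: "nat \<Rightarrow> (nat \<Rightarrow> 'v \<Rightarrow> 'k::comm_ring_1) \<Rightarrow> bool" where
  "algebraically_independent n f \<longleftrightarrow>
     (\<forall>p. (\<forall>m\<in>Poly_Mapping.keys p. Poly_Mapping.keys m \<subseteq> {..<n}) \<longrightarrow>
          eval_poly p f = 0 \<longrightarrow> p = 0)"

definition GL :: "('k::field \<Rightarrow> 'v::ab_group_add \<Rightarrow> 'v) \<Rightarrow> ('v \<Rightarrow> 'v) monoid" where
  "GL smul =
     \<lparr>carrier = {g. Vector_Spaces.linear smul smul g \<and> bij g}, mult = (\<circ>), one = id\<rparr>"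

definition hyperplane :: "('k::field \<Rightarrow> 'v::ab_group_add \<Rightarrow> 'v) \<Rightarrow> 'v set \<Rightarrow> bool" where
  "hyperplane smul H \<longleftrightarrow>
     module.subspace smul H \<and> vector_space.dim smul H + 1 = vector_space.dim smul UNIV"

definition pseudoreflection ::
    "('k::field \<Rightarrow> 'v::ab_group_add \<Rightarrow> 'v) \<Rightarrow> ('v \<Rightarrow> 'v) \<Rightarrow> bool" where
  "pseudoreflection smul g \<longleftrightarrow>
     Vector_Spaces.linear smul smul g \<and> hyperplane smul {v. g v = v}"

definition matrix_in_basis ::
    "('k::field \<Rightarrow> 'v::ab_group_add \<Rightarrow> 'v) \<Rightarrow> ('n::finite \<Rightarrow> 'v) \<Rightarrow> ('v \<Rightarrow> 'v) \<Rightarrow> 'k ^ 'n ^ 'n" where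
  "matrix_in_basis smul b g = (\<chi> i j. module.representation smul (range b) (g (b j)) (b i))"

text \<open>Only meaningful if \<open>W\<close> is \<open>G\<close>-invariant: otherwise the matrices are not those of
  the restrictions to \<open>W\<close>.\<close>

definition restricts_to_SL2 ::
    "('k::field \<Rightarrow> 'v::ab_group_add \<Rightarrow> 'v) \<Rightarrow> ('v \<Rightarrow> 'v) set \<Rightarrow> 'v set \<Rightarrow> 'k set \<Rightarrow> bool" where
  "restricts_to_SL2 smul G W F \<longleftrightarrow>
     (\<exists>b :: 2 \<Rightarrow> 'v. inj b \<and> \<not> module.dependent smul (range b) \<and>
        module.span smul (range b) = W \<and> matrix_in_basis smul b ` G = SL F)"

definition dual_space :: "('k::field \<Rightarrow> 'v::ab_group_add \<Rightarrow> 'v) \<Rightarrow> ('v \<Rightarrow> 'k) set" where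
  "dual_space smul = {l. Vector_Spaces.linear smul (*) l}"

text \<open>The symmetric algebra \<open>S(V\<^sup>*)\<close>, realised as the algebra of polynomial functions on \<open>V\<close>,
  and its homogeneous component \<open>S\<^sup>d(V\<^sup>*)\<close>. Over an infinite field (in particular, over an
  algebraically closed one) this realisation is faithful.\<close>

definition sym_algebra :: "('k::field \<Rightarrow> 'v::ab_group_add \<Rightarrow> 'v) \<Rightarrow> ('v \<Rightarrow> 'k) set" where
  "sym_algebra smul = generated_algebra (dual_space smul)"

definition sym_power :: "('k::field \<Rightarrow> 'v::ab_group_add \<Rightarrow> 'v) \<Rightarrow> nat \<Rightarrow> ('v \<Rightarrow> 'k) set" where
  "sym_power smul d =
     module.span (\<lambda>c f v. c * f v) {\<lambda>v. \<Prod>i<d. l i v | l. \<forall>i<d. l i \<in> dual_space smul}"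

definition homogeneous :: "('k::field \<Rightarrow> 'v::ab_group_add \<Rightarrow> 'v) \<Rightarrow> ('v \<Rightarrow> 'k) \<Rightarrow> bool" where
  "homogeneous smul f \<longleftrightarrow> (\<exists>d. f \<in> sym_power smul d)"

definition act :: "('v \<Rightarrow> 'v) \<Rightarrow> ('v \<Rightarrow> 'k) \<Rightarrow> 'v \<Rightarrow> 'k" where
  "act g f = (\<lambda>v. f (inv_into UNIV g v))"

definition invariants ::
    "('k::field \<Rightarrow> 'v::ab_group_add \<Rightarrow> 'v) \<Rightarrow> ('v \<Rightarrow> 'v) set \<Rightarrow> ('v \<Rightarrow> 'k) set" where
  "invariants smul G = {f \<in> sym_algebra smul. \<forall>g\<in>G. act g f = f}"

definition polynomial_ring ::
    "('k::field \<Rightarrow> 'v::ab_group_add \<Rightarrow> 'v) \<Rightarrow> ('v \<Rightarrow> 'k) set \<Rightarrow> bool" where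
  "polynomial_ring smul R \<longleftrightarrow>
     (let n = vector_space.dim smul UNIV in
      \<exists>f :: nat \<Rightarrow> 'v \<Rightarrow> 'k. (\<forall>i<n. homogeneous smul (f i)) \<and>
        algebraically_independent n f \<and> generated_algebra (f ` {..<n}) = R)"

lemma (in vector_space) group_GL: "Group.group (GL scale)"
proof (rule groupI)
  fix x assume "x \<in> carrier (GL scale)"
  then have x: "Vector_Spaces.linear scale scale x" "bij x" by (auto simp: GL_def)
  interpret x: Vector_Spaces.linear scale scale x by (rule x)
  have *: "x (inv_into UNIV x v) = v" for v
    using x(2) by (simp add: bij_is_surj surj_f_inv_f)
  have "inv_into UNIV x (v + w) = inv_into UNIV x v + inv_into UNIV x w" for v w
    by (rule injD[OF bij_is_inj[OF x(2)]]) (simp add: * x.add)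
  moreover have "inv_into UNIV x (scale c v) = scale c (inv_into UNIV x v)" for c v
    by (rule injD[OF bij_is_inj[OF x(2)]]) (simp add: * x.scale)
  ultimately have "Vector_Spaces.linear scale scale (inv_into UNIV x)"
    by unfold_locales auto
  then show "\<exists>y\<in>carrier (GL scale). y \<otimes>\<^bsub>GL scale\<^esub> x = \<one>\<^bsub>GL scale\<^esub>"
    using x(2) by (intro bexI[of _ "inv_into UNIV x"])
      (auto simp: GL_def bij_imp_bij_inv bij_is_inj)
qed (auto simp: GL_def o_assoc bij_comp linear_id intro: Vector_Spaces.linear_compose)

end

theory Submission
  imports Defs
begin

text \<open>
  Choose coordinates \<open>x\<close>, \<open>y\<close>, \<open>z\<close> on \<open>V\<close> with \<open>W = {z = 0}\<close>. Elements of \<open>2\<close>-power order act trivially on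
  \<open>V / W\<close>, so \<open>G\<close> consists of affine maps \<open>(x, y) \<mapsto> A (x, y) + z (p, r)\<close> with \<open>A \<in> SL\<^sub>2(F)\<close>, \<open>q = |F|\<close>. The translations
  in \<open>G\<close> form \<open>U \<times> U\<close> for a finite \<open>F\<close>-subspace \<open>U\<close> of \<open>k\<close>, and their invariants are the polynomials in
  \<open>z\<close>, \<open>\<xi> = \<Prod>\<^sub>u (x + u z)\<close> and \<open>\<eta> = \<Prod>\<^sub>u (y + u z)\<close>. As these products are \<open>F\<close>-linear in \<open>x\<close> and \<open>y\<close>, the
  quotient \<open>SL\<^sub>2(F)\<close> acts on \<open>\<xi>\<close>, \<open>\<eta>\<close> by affine maps with a cocycle that, since \<open>F\<close> contains some \<open>t \<noteq> 0, 1\<close>,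
  can be normalised to vanish on the torus and on the Weyl element. Then the unipotent
  elements act by \<open>\<xi> \<mapsto> \<xi> + s\<^sup>2 \<eta> + s \<zeta>\<close> with \<open>\<zeta> = c z\<^sup>e\<close>, \<open>e = |U|\<close>, that is, as on binary
  quadratic forms with coefficients \<open>(\<eta>, \<zeta>, \<xi>)\<close>. The products of the values of this form over
  the points of the projective lines over \<open>F\<close> and over the field with \<open>q\<^sup>2\<close> elements without those over \<open>F\<close> are invariants \<open>f2\<close> and \<open>f3\<close>, which for
  \<open>z = 0\<close> become the Dickson invariants of \<open>SL\<^sub>2(F)\<close>. Subtracting polynomials in \<open>f2\<close> and \<open>f3\<close>, one makes any
  invariant divisible by \<open>z\<close>, and induction on the degree shows that \<open>z\<close>, \<open>f2\<close>, \<open>f3\<close> generate.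
\<close>

section \<open>Polynomial functions of weighted degree at most \<open>d\<close>\<close>

text \<open>The variables have weights \<open>a\<close>, \<open>b\<close>, \<open>c\<close>. The degree bound is an integer, so that dividing by a
  variable lowers it without side conditions; for negative \<open>d\<close> only the zero function is left.\<close>

inductive wpol :: "nat \<Rightarrow> nat \<Rightarrow> nat \<Rightarrow> int \<Rightarrow> ('k::comm_ring_1 \<Rightarrow> 'k \<Rightarrow> 'k \<Rightarrow> 'k) \<Rightarrow> bool"
  for a b c where
  zero: "wpol a b c d (\<lambda>x y z. 0)"
| const: "0 \<le> d \<Longrightarrow> wpol a b c d (\<lambda>x y z. t)"
| fst: "int a \<le> d \<Longrightarrow> wpol a b c d (\<lambda>x y z. x)"
| snd: "int b \<le> d \<Longrightarrow> wpol a b c d (\<lambda>x y z. y)"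
| thd: "int c \<le> d \<Longrightarrow> wpol a b c d (\<lambda>x y z. z)"
| add: "wpol a b c d f \<Longrightarrow> wpol a b c d g \<Longrightarrow> wpol a b c d (\<lambda>x y z. f x y z + g x y z)"
| mult: "wpol a b c d f \<Longrightarrow> wpol a b c d' g \<Longrightarrow>
    wpol a b c (d + d') (\<lambda>x y z. f x y z * g x y z)"

text \<open>With all weights zero the bound says nothing.\<close>

abbreviation polyfun :: "('k::comm_ring_1 \<Rightarrow> 'k \<Rightarrow> 'k \<Rightarrow> 'k) \<Rightarrow> bool" where
  "polyfun \<equiv> wpol 0 0 0 0"

lemma wpol_mono:
  assumes "wpol a b c d f" "d \<le> d'" shows "wpol a b c d' f"
  using assms
proof (induction arbitrary: d')
  case (mult d1 f d2 g)
  \<comment> \<open>The whole slack of the bound is given to the second factor.\<close>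
  have "wpol a b c (d1 + (d' - d1)) (\<lambda>x y z. f x y z * g x y z)"
    by (intro wpol.mult mult.IH) (use mult.prems in auto)
  then show ?case by simp
qed (auto intro: wpol.intros)

lemma wpol_mult_le:
  assumes "wpol a b c d1 f" "wpol a b c d2 g" "d1 + d2 \<le> d"
  shows "wpol a b c d (\<lambda>x y z. f x y z * g x y z)"
  using wpol_mono[OF wpol.mult[OF assms(1,2)] assms(3)] .

lemma wpol_uminus:
  assumes "wpol a b c d f" shows "wpol a b c d (\<lambda>x y z. - f x y z)"
  using wpol_mult_le[OF wpol.const[of 0 a b c "-1"] assms] by simp

lemma wpol_diff:
  assumes "wpol a b c d f" "wpol a b c d g" shows "wpol a b c d (\<lambda>x y z. f x y z - g x y z)"
  using wpol.add[OF assms(1) wpol_uminus[OF assms(2)]] by simp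

lemma wpol_scale:
  assumes "wpol a b c d f" shows "wpol a b c d (\<lambda>x y z. t * f x y z)"
  using wpol_mult_le[OF wpol.const[of 0 a b c t] assms] by simp

lemma wpol_prod:
  assumes "\<And>i. i \<in> I \<Longrightarrow> wpol a b c d (f i)"
  shows "wpol a b c (d * int (card I)) (\<lambda>x y z. \<Prod>i\<in>I. f i x y z)"
proof (cases "finite I")
  case True
  then show ?thesis using assms
  proof (induction I)
    case (insert i I)
    then have "wpol a b c (d + d * int (card I)) (\<lambda>x y z. f i x y z * (\<Prod>i\<in>I. f i x y z))"
      by (intro wpol.mult) auto
    with insert show ?case by (simp add: algebra_simps)
  qed (auto intro: wpol.intros)
qed (auto intro: wpol.intros)

lemma wpol_sum:
  assumes "\<And>i. i \<in> I \<Longrightarrow> wpol a b c d (f i)"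
  shows "wpol a b c d (\<lambda>x y z. \<Sum>i\<in>I. f i x y z)"
  using assms
  by (induction I rule: infinite_finite_induct) (auto intro: wpol.intros)

lemma wpol_power:
  assumes "wpol a b c d f"
  shows "wpol a b c (d * int m) (\<lambda>x y z. f x y z ^ m)"
  using wpol_prod[of "{..<m}" a b c d "\<lambda>_. f"] assms by simp

lemma wpol_subst:
  assumes "wpol a b c d f"
    and g: "wpol a' b' c' (int a) g1" "wpol a' b' c' (int b) g2" "wpol a' b' c' (int c) g3"
  shows "wpol a' b' c' d (\<lambda>x y z. f (g1 x y z) (g2 x y z) (g3 x y z))"
  using assms(1)
  by induction (auto intro: wpol.intros wpol_mono[OF g(1)] wpol_mono[OF g(2)] wpol_mono[OF g(3)])

text \<open>Weights are natural numbers, so constants and variables need a nonnegative bound, and a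
  product of negative degree has a factor of negative degree. The later inductions on the degree
  bottom out here.\<close>

lemma wpol_neg:
  assumes "wpol a b c d f" "d < 0" shows "f x y z = 0"
  using assms by induction (auto, fastforce)

text \<open>Positive weights exclude the variables at degree 0. In a product either one factor has a
  negative bound and vanishes, or both bounds are 0.\<close>

lemma wpol_0_const:
  assumes "wpol (Suc a) (Suc b) (Suc c) d f" "d \<le> 0" shows "\<exists>t. \<forall>x y z. f x y z = t"
  using assms
proof induction
  case (mult d1 f d2 g)
  consider "d1 < 0" | "d2 < 0" | "d1 \<le> 0" "d2 \<le> 0" using mult.prems by linarith
  then show ?case
  proof cases
    case 1
    show ?thesis using wpol_neg[OF mult.hyps(1) 1] by auto
  next
    case 2
    show ?thesis using wpol_neg[OF mult.hyps(2) 2] by auto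
  next
    case 3
    with mult.IH show ?thesis by force
  qed
qed force+

lemma wpol_imp_polyfun:
  assumes "wpol a b c d f" shows "polyfun f"
  using assms
proof induction
  case (mult d f d' g)
  show ?case using wpol.mult[OF mult.IH] by simp
qed (auto intro: wpol.intros)

lemma polyfun_imp_wpol:
  assumes "polyfun f" shows "\<exists>d\<ge>0. wpol a b c d f"
proof -
  have "\<exists>d\<ge>0. wpol a b c d f" if "wpol 0 0 0 d' f" for d'
    using that
  proof induction
    case (add d f g)
    then obtain d1 d2 where "0 \<le> d1" "wpol a b c d1 f" "0 \<le> d2" "wpol a b c d2 g" by blast
    then have "wpol a b c (max d1 d2) f" "wpol a b c (max d1 d2) g"
      by (auto elim: wpol_mono)
    then show ?case using \<open>0 \<le> d1\<close> by (intro exI[of _ "max d1 d2"]) (auto intro: wpol.add)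
  next
    case (mult d f d' g)
    then obtain d1 d2 where "0 \<le> d1" "wpol a b c d1 f" "0 \<le> d2" "wpol a b c d2 g" by blast
    then show ?case by (intro exI[of _ "d1 + d2"]) (auto intro: wpol.mult)
  next
    case (fst d) then show ?case by (intro exI[of _ "int a"]) (auto intro: wpol.intros)
  next
    case (snd d) then show ?case by (intro exI[of _ "int b"]) (auto intro: wpol.intros)
  next
    case (thd d) then show ?case by (intro exI[of _ "int c"]) (auto intro: wpol.intros)
  qed (auto intro: wpol.intros)
  with assms show ?thesis by blast
qed

lemma polyfun_subst:
  assumes "polyfun f" "polyfun g1" "polyfun g2" "polyfun g3"
  shows "polyfun (\<lambda>x y z. f (g1 x y z) (g2 x y z) (g3 x y z))"
  using wpol_subst[OF assms(1)] assms(2-4) by simp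

lemma polyfun_mult:
  assumes "polyfun f" "polyfun g" shows "polyfun (\<lambda>x y z. f x y z * g x y z)"
  using wpol.mult[OF assms] by simp

text \<open>Reduces questions in three variables to polynomials in one variable, which have finitely
  many roots and no zero divisors.\<close>

lemma polyfun_curve:
  fixes p1 p2 p3 :: "'k::comm_ring_1 poly"
  assumes "polyfun f"
  shows "\<exists>p. \<forall>t. f (poly p1 t) (poly p2 t) (poly p3 t) = poly p t"
proof -
  have "\<exists>p. \<forall>t. f (poly p1 t) (poly p2 t) (poly p3 t) = poly p t" if "wpol 0 0 0 d f" for d
    using that
  proof induction
    case (zero d) show ?case by (intro exI[of _ 0]) auto
  next
    case (const d t) show ?case by (intro exI[of _ "[:t:]"]) auto
  next
    case (add d f g) then show ?case by (metis poly_add)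
  next
    case (mult d f d' g) then show ?case by (metis poly_mult)
  qed auto
  with assms show ?thesis by blast
qed

text \<open>The bound is conditional because the zero function satisfies every bound, even a
  negative one.\<close>

lemma wpol_axis_poly:
  fixes f :: "'k::idom \<Rightarrow> 'k \<Rightarrow> 'k \<Rightarrow> 'k"
  assumes "wpol a b c d f"
  shows "\<exists>p. (\<forall>t. f t 0 0 = poly p t) \<and> (p \<noteq> 0 \<longrightarrow> int (a * degree p) \<le> d)"
  using assms
proof induction
  case (zero d) show ?case by (intro exI[of _ 0]) auto
next
  case (const d t) then show ?case by (intro exI[of _ "[:t:]"]) auto
next
  case (fst d) then show ?case by (intro exI[of _ "[:0, 1:]"]) auto
next
  case (add d f g)
  then obtain p q where pq: "\<forall>t. f t 0 0 = poly p t" "p \<noteq> 0 \<longrightarrow> int (a * degree p) \<le> d"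
    "\<forall>t. g t 0 0 = poly q t" "q \<noteq> 0 \<longrightarrow> int (a * degree q) \<le> d" by blast
  have "int (a * degree (p + q)) \<le> d" if nz: "p + q \<noteq> 0"
  proof -
    have *: "degree (p + q) \<le> degree p \<or> degree (p + q) \<le> degree q"
      using degree_add_le_max[of p q] by linarith
    \<comment> \<open>A zero summand carries no degree bound, so a nonzero summand of at least the
      degree of the sum is selected.\<close>
    have "\<exists>r\<in>{p, q}. r \<noteq> 0 \<and> degree (p + q) \<le> degree r"
    proof (cases "p = 0 \<or> q = 0")
      case True then show ?thesis using nz by auto
    next
      case False then show ?thesis using * by auto
    qed
    then obtain r where r: "r \<in> {p, q}" "r \<noteq> 0" "degree (p + q) \<le> degree r" by blast
    have "int (a * degree (p + q)) \<le> int (a * degree r)" using r(3) by (simp add: mult_left_mono)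
    also have "\<dots> \<le> d" using r pq by auto
    finally show ?thesis .
  qed
  with pq show ?case by (intro exI[of _ "p + q"]) auto
next
  case (mult d f d' g)
  then obtain p q where pq: "\<forall>t. f t 0 0 = poly p t" "p \<noteq> 0 \<longrightarrow> int (a * degree p) \<le> d"
    "\<forall>t. g t 0 0 = poly q t" "q \<noteq> 0 \<longrightarrow> int (a * degree q) \<le> d'" by blast
  show ?case
    by (intro exI[of _ "p * q"]) (use pq in \<open>auto simp: degree_mult_eq algebra_simps\<close>)
qed (auto intro: exI[of _ 0])

section \<open>Identities between polynomial functions over an algebraically closed field\<close>

lemma infinite_UNIV_alg_closed: "infinite (UNIV :: 'k::alg_closed_field set)"
proof
  assume fin: "finite (UNIV :: 'k set)"
  \<comment> \<open>If the field were finite, this product plus 1 would be a nonconstant polynomial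
    without roots.\<close>
  define p :: "'k poly" where "p = (\<Prod>a\<in>UNIV. [:- a, 1:])"
  have deg: "degree p = card (UNIV :: 'k set)"
    unfolding p_def by (subst degree_prod_eq_sum_degree) auto
  have "card (UNIV :: 'k set) > 0" using fin by (simp add: finite_UNIV_card_ge_0)
  then have "degree (p + 1) > 0" using deg by (simp add: degree_add_eq_left)
  then obtain x where "poly (p + 1) x = 0" using alg_closed_imp_poly_has_root by blast
  moreover have "poly p x = 0" unfolding p_def poly_prod using fin by (auto intro!: prod_zero bexI[of _ x])
  ultimately show False by simp
qed

lemma poly_eqI_alg_closed:
  fixes p q :: "'k::alg_closed_field poly"
  assumes "\<And>x. poly p x = poly q x" shows "p = q"
proof -
  have "poly (p - q) x = 0" for x using assms by simp
  then have "p - q = 0"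
    using poly_roots_finite[of "p - q"] infinite_UNIV_alg_closed[where 'k='k] by auto
  then show ?thesis by simp
qed

text \<open>Both functions are restricted to the line from \<open>(x0, y0, z0)\<close> at parameter
  0 to \<open>(x, y, z)\<close> at parameter 1. There the product is the zero polynomial and the
  first factor is not.\<close>

lemma polyfun_mult_eq_0:
  fixes f g :: "'k::alg_closed_field \<Rightarrow> 'k \<Rightarrow> 'k \<Rightarrow> 'k"
  assumes "polyfun f" "polyfun g" "\<And>x y z. f x y z * g x y z = 0"
    and "f x0 y0 z0 \<noteq> 0"
  shows "g x y z = 0"
proof -
  let ?l = "\<lambda>u v :: 'k. [:u, v - u:]"
  obtain p where p: "f (poly (?l x0 x) t) (poly (?l y0 y) t) (poly (?l z0 z) t) = poly p t" for t
    using polyfun_curve[OF assms(1)] by blast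
  obtain q where q: "g (poly (?l x0 x) t) (poly (?l y0 y) t) (poly (?l z0 z) t) = poly q t" for t
    using polyfun_curve[OF assms(2)] by blast
  have "p * q = 0"
    by (rule poly_eqI_alg_closed) (simp add: p[symmetric] q[symmetric] assms(3))
  moreover have "p \<noteq> 0" using p[of 0] assms(4) by auto
  ultimately have "q = 0" by simp
  then show ?thesis using q[of 1] by simp
qed

lemma polyfun_cancel:
  fixes f g h :: "'k::alg_closed_field \<Rightarrow> 'k \<Rightarrow> 'k \<Rightarrow> 'k"
  assumes "polyfun h" "polyfun f" "polyfun g"
    and "\<And>x y z. h x y z * f x y z = h x y z * g x y z" and "h x0 y0 z0 \<noteq> 0"
  shows "f x y z = g x y z"
proof -
  have "f x y z - g x y z = 0"
    by (rule polyfun_mult_eq_0[OF assms(1) wpol_diff[OF assms(2,3)] _ assms(5)])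
      (simp only: right_diff_distrib assms(4) diff_self)
  then show ?thesis by simp
qed

section \<open>Splitting off linear factors\<close>

lemma wpol_split_fst:
  assumes "wpol a b c d f"
  shows "\<exists>g. wpol a b c (d - int a) g \<and> (\<forall>x y z. f x y z = f 0 y z + x * g x y z)"
  using assms
proof induction
  case (fst d)
  then show ?case by (intro exI[of _ "\<lambda>x y z. 1"]) (auto intro: wpol.const)
next
  case (add d f g)
  then obtain f' g' where fg: "wpol a b c (d - int a) f'" "\<And>x y z. f x y z = f 0 y z + x * f' x y z"
    "wpol a b c (d - int a) g'" "\<And>x y z. g x y z = g 0 y z + x * g' x y z" by blast
  have "f x y z + g x y z = (f 0 y z + g 0 y z) + x * (f' x y z + g' x y z)" for x y z
    by (subst (1) fg(2), subst (1) fg(4)) (simp add: algebra_simps)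
  with wpol.add[OF fg(1,3)] show ?case by blast
next
  case (mult d f d' g)
  then obtain f' g' where fg: "wpol a b c (d - int a) f'" "\<And>x y z. f x y z = f 0 y z + x * f' x y z"
    "wpol a b c (d' - int a) g'" "\<And>x y z. g x y z = g 0 y z + x * g' x y z" by blast
  have "wpol a b c d (\<lambda>x y z. f 0 y z)"
    by (rule wpol_subst[OF mult.hyps(1)]) (auto intro: wpol.intros)
  then have "wpol a b c (d + d' - int a) (\<lambda>x y z. f 0 y z * g' x y z + f' x y z * g x y z)"
    by (intro wpol.add wpol_mult_le[OF _ fg(3)] wpol_mult_le[OF fg(1) mult.hyps(2)]) auto
  \<comment> \<open>Telescoping: f g - f0 g0 = f0 (g - g0) + (f - f0) g, where the index 0 means the
    value at \<open>x = 0\<close>.\<close>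
  moreover have "f x y z * g x y z = f 0 y z * g 0 y z + x * (f 0 y z * g' x y z + f' x y z * g x y z)" for x y z
    by (subst (1) fg(2), subst (1 2) fg(4)) (simp add: algebra_simps)
  ultimately show ?case by blast
qed (auto intro!: exI[of _ "\<lambda>x y z. 0"] wpol.zero)

lemma wpol_split_thd:
  assumes "wpol a b c d f"
  shows "\<exists>g. wpol a b c (d - int c) g \<and> (\<forall>x y z. f x y z = f x y 0 + z * g x y z)"
proof -
  have "wpol c b a d (\<lambda>x y z. f z y x)"
    by (rule wpol_subst[OF assms]) (auto intro: wpol.intros)
  from wpol_split_fst[OF this] obtain g where g: "wpol c b a (d - int c) g"
    "\<forall>x y z. f z y x = f z y 0 + x * g x y z" by blast
  have "wpol a b c (d - int c) (\<lambda>x y z. g z y x)"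
    by (rule wpol_subst[OF g(1)]) (auto intro: wpol.intros)
  with g(2) show ?thesis by blast
qed

lemma wpol_split_snd:
  assumes "wpol a b c d f"
  shows "\<exists>g. wpol a b c (d - int b) g \<and> (\<forall>x y z. f x y z = f x 0 z + y * g x y z)"
proof -
  have "wpol b a c d (\<lambda>x y z. f y x z)"
    by (rule wpol_subst[OF assms]) (auto intro: wpol.intros)
  from wpol_split_fst[OF this] obtain g where g: "wpol b a c (d - int b) g"
    "\<forall>x y z. f y x z = f y 0 z + x * g x y z" by blast
  have "wpol a b c (d - int b) (\<lambda>x y z. g y x z)"
    by (rule wpol_subst[OF g(1)]) (auto intro: wpol.intros)
  with g(2) show ?thesis by blast
qed

text \<open>Factor theorem for the linear factors \<open>x - u * l y z\<close>: a shift of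
  \<open>x\<close> moves one root to 0, where it is split off. The remaining roots survive in the
  quotient, since two roots differ by \<open>(v - u) * l y z\<close>, which is not the zero function
  and can be cancelled.\<close>

lemma wpol_dvd_prod:
  fixes f :: "'k::alg_closed_field \<Rightarrow> 'k \<Rightarrow> 'k \<Rightarrow> 'k"
  assumes "finite U" and l: "wpol a b c (int a) (\<lambda>x. l)" "l y0 z0 \<noteq> 0"
    and "wpol a b c d f" and "\<And>u y z. u \<in> U \<Longrightarrow> f (u * l y z) y z = 0"
  shows "\<exists>g. wpol a b c (d - int (a * card U)) g \<and>
    (\<forall>x y z. f x y z = (\<Prod>u\<in>U. x - u * l y z) * g x y z)"
  using assms(1,4,5)
proof (induction U arbitrary: d f)
  case empty
  then show ?case by (intro exI[of _ f]) auto
next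
  case (insert u U)
  have "wpol a b c d (\<lambda>x y z. f (x + u * l y z) y z)"
    by (rule wpol_subst[OF insert.prems(1)]) (auto intro!: wpol.intros wpol_scale[OF l(1)])
  from wpol_split_fst[OF this] obtain g where g: "wpol a b c (d - int a) g"
    "\<And>x y z. f (x + u * l y z) y z = f (u * l y z) y z + x * g x y z" by auto
  define h where "h = (\<lambda>x y z. g (x - u * l y z) y z)"
  have h: "wpol a b c (d - int a) h" unfolding h_def
    by (rule wpol_subst[OF g(1)]) (auto intro!: wpol.intros wpol_diff wpol_scale[OF l(1)])
  have fh: "f x y z = (x - u * l y z) * h x y z" for x y z
    using g(2)[of "x - u * l y z" y z] insert.prems(2)[of u] by (simp add: h_def)
  have "h (v * l y z) y z = 0" if "v \<in> U" for v y z
  proof (rule polyfun_mult_eq_0[of "\<lambda>x y z. (v - u) * l y z" "\<lambda>x y z. h (v * l y z) y z" 0 y0 z0])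
    show "(v - u) * l y z * h (v * l y z) y z = 0" for y z
      using fh[of "v * l y z" y z] insert.prems(2)[of v] that by (auto simp: algebra_simps)
    show "polyfun (\<lambda>x y z. h (v * l y z) y z)"
      by (rule polyfun_subst[OF wpol_imp_polyfun[OF h]])
        (auto intro!: wpol.intros wpol_scale wpol_imp_polyfun[OF l(1)])
    show "polyfun (\<lambda>x y z. (v - u) * l y z)"
      by (intro wpol_scale wpol_imp_polyfun[OF l(1)])
    show "(v - u) * l y0 z0 \<noteq> 0" using l(2) that insert.hyps by auto
  qed
  from insert.IH[OF h this] obtain g' where g': "wpol a b c (d - int a - int (a * card U)) g'"
    "\<forall>x y z. h x y z = (\<Prod>u\<in>U. x - u * l y z) * g' x y z" by blast
  show ?case
    by (rule exI[of _ g']) (use g' insert.hyps fh in \<open>auto simp: algebra_simps\<close>)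
qed

section \<open>Invariants of finite translation groups\<close>

lemma polyfun_prod:
  assumes "\<And>i. i \<in> I \<Longrightarrow> polyfun (f i)"
  shows "polyfun (\<lambda>x y z. \<Prod>i\<in>I. f i x y z)"
  using wpol_prod[OF assms] by simp

lemma ex_notin_finite: "\<exists>x::'k::alg_closed_field. x \<notin> A" if "finite A"
  using ex_new_if_finite[OF infinite_UNIV_alg_closed that] .

lemma prod_linear_ne_0:
  fixes h :: "'b \<Rightarrow> 'k::alg_closed_field"
  assumes "finite U" shows "\<exists>x. (\<Prod>u\<in>U. x + h u) \<noteq> 0"
proof -
  obtain x where "x \<notin> (\<lambda>u. - h u) ` U" using ex_notin_finite[of "(\<lambda>u. - h u) ` U"] assms by auto
  then have "(\<Prod>u\<in>U. x + h u) \<noteq> 0" using assms by (auto simp: image_iff add_eq_0_iff2)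
  then show ?thesis ..
qed

text \<open>Induction on the degree in \<open>x\<close>, counted by the weights
  \<open>1 0 0\<close>. The difference of \<open>f\<close> and its value at \<open>x = 0\<close>
  vanishes at all \<open>x = u * l y z\<close>, hence is divisible by the orbit product
  \<open>N\<close>; as \<open>N\<close> is invariant, so is the quotient.\<close>

lemma translation_invariant:
  fixes f :: "'k::alg_closed_field \<Rightarrow> 'k \<Rightarrow> 'k \<Rightarrow> 'k"
  assumes U: "finite U" "0 \<in> U" "\<And>u v. u \<in> U \<Longrightarrow> v \<in> U \<Longrightarrow> u + v \<in> U" "\<And>u. u \<in> U \<Longrightarrow> - u \<in> U"
    and l: "polyfun (\<lambda>x. l)" "l y0 z0 \<noteq> 0"
    and f: "polyfun f" "\<And>u x y z. u \<in> U \<Longrightarrow> f (x + u * l y z) y z = f x y z"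
  shows "\<exists>G. polyfun G \<and> (\<forall>x y z. f x y z = G (\<Prod>u\<in>U. x + u * l y z) y z)"
proof -
  \<comment> \<open>As \<open>l\<close> ignores \<open>x\<close>, substituting 0 for
    \<open>x\<close> leaves it unchanged and shows that its degree in \<open>x\<close> is 0.\<close>
  have l0: "wpol 1 0 0 0 (\<lambda>x. l)"
    by (rule wpol_subst[OF l(1), of 1 0 0 "\<lambda>x y z. 0" "\<lambda>x y z. y" "\<lambda>x y z. z"])
      (auto intro: wpol.intros)
  define N where "N = (\<lambda>x y z. \<Prod>u\<in>U. x + u * l y z)"
  have N': "N x y z = (\<Prod>u\<in>U. x - u * l y z)" for x y z
    unfolding N_def by (rule prod.reindex_bij_witness[of _ uminus uminus]) (auto simp: U(4))
  have N_shift: "N (x + v * l y z) y z = N x y z" if "v \<in> U" for v x y z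
    unfolding N_def
  proof (rule prod.reindex_bij_witness[of _ "\<lambda>u. u + - v" "\<lambda>u. u + v"])
    show "u + - v \<in> U" "u + v \<in> U" if "u \<in> U" for u
      using U(3)[OF that U(4)[OF \<open>v \<in> U\<close>]] U(3)[OF that \<open>v \<in> U\<close>] by auto
  qed (simp_all add: distrib_right add.assoc add.commute)
  have pN: "polyfun N"
    unfolding N_def by (intro polyfun_prod wpol.add wpol.fst wpol_scale l(1)) auto
  obtain x0 where x0: "N x0 y0 z0 \<noteq> 0"
    using prod_linear_ne_0[OF U(1), of "\<lambda>u. u * l y0 z0"] by (auto simp: N_def)
  have "\<exists>G. polyfun G \<and> (\<forall>x y z. f x y z = G (N x y z) y z)"
    if "wpol 1 0 0 d f" "\<And>u x y z. u \<in> U \<Longrightarrow> f (x + u * l y z) y z = f x y z" for d f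
    using that
  proof (induction "nat (d + 1)" arbitrary: d f rule: less_induct)
    case less
    show ?case
    proof (cases "d < 0")
      case True
      then show ?thesis using wpol_neg[OF less.prems(1)] by (auto intro: wpol.zero)
    next
      case False
      have f0: "wpol 1 0 0 d (\<lambda>x y z. f 0 y z)"
        by (rule wpol_subst[OF less.prems(1)]) (auto intro: wpol.intros)
      have "wpol 1 0 0 d (\<lambda>x y z. f x y z - f 0 y z)"
        by (rule wpol_diff[OF less.prems(1) f0])
      moreover have "f (u * l y z) y z - f 0 y z = 0" if "u \<in> U" for u y z
        using less.prems(2)[OF that, of 0] by simp
      moreover have "wpol 1 0 0 (int 1) (\<lambda>x. l)" by (rule wpol_mono[OF l0]) simp
      ultimately obtain g where g: "wpol 1 0 0 (d - int (1 * card U)) g"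
        "\<forall>x y z. f x y z - f 0 y z = (\<Prod>u\<in>U. x - u * l y z) * g x y z"
        using wpol_dvd_prod[of U 1 0 0 l y0 z0 d "\<lambda>x y z. f x y z - f 0 y z", OF U(1) _ l(2)]
        by blast
      have fg: "f x y z = f 0 y z + N x y z * g x y z" for x y z
        using g(2)[rule_format, of x y z] unfolding N' by (metis add_diff_cancel_left' add_diff_eq)
      have "g (x + u * l y z) y z = g x y z" if "u \<in> U" for u x y z
      proof (rule polyfun_cancel[where h = N and g = g and f = "\<lambda>x y z. g (x + u * l y z) y z",
            OF pN _ _ _ x0])
        show g': "polyfun g" by (rule wpol_imp_polyfun[OF g(1)])
        show "polyfun (\<lambda>x y z. g (x + u * l y z) y z)"
          by (intro polyfun_subst[OF g'] wpol.add wpol.fst wpol.snd wpol.thd wpol_scale l(1)) auto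
        show "N x y z * g (x + u * l y z) y z = N x y z * g x y z" for x y z
          using fg[of "x + u * l y z" y z] fg[of x y z] less.prems(2)[OF that] N_shift[OF that]
          by auto
      qed
      moreover have "card U > 0" using U(1,2) by (auto simp: card_gt_0_iff)
      ultimately obtain G where G: "polyfun G" "\<And>x y z. g x y z = G (N x y z) y z"
        using less.hyps[OF _ g(1)] False by auto
      have "polyfun (\<lambda>x y z. f 0 y z + x * G x y z)"
        by (intro wpol.add polyfun_mult G(1) wpol_imp_polyfun[OF f0] wpol.fst) auto
      moreover have "f x y z = f 0 y z + N x y z * G (N x y z) y z" for x y z
        unfolding fg[of x y z] G(2)[of x y z] ..
      ultimately show ?thesis by (intro exI[of _ "\<lambda>x y z. f 0 y z + x * G x y z"]) blast
    qed
  qed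
  then show ?thesis using polyfun_imp_wpol[OF f(1)] f(2) unfolding N_def by blast
qed

section \<open>Finite sets of scalars, and exponents forced by invariance\<close>

lemma power_card_eq_self:
  fixes s :: "'k::field"
  assumes U: "finite U" "0 \<in> U" "s \<noteq> 0" "\<And>u. u \<in> U \<Longrightarrow> s * u \<in> U"
  shows "s ^ card U = s"
proof -
  \<comment> \<open>Multiplication by \<open>s\<close> permutes the nonzero elements of
    \<open>U\<close>; comparing their products gives \<open>s ^ card ?V = 1\<close>.\<close>
  let ?V = "U - {0}"
  have inj: "inj_on ((*) s) ?V" using U(3) by (auto simp: inj_on_def)
  have "(*) s ` ?V = ?V" by (rule endo_inj_surj) (use U inj in auto)
  then have "(\<Prod>u\<in>?V. s * u) = \<Prod>?V"
    using prod.reindex[OF inj, of id] by (simp add: o_def)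
  then have "s ^ card ?V * \<Prod>?V = \<Prod>?V" by (simp add: prod.distrib)
  moreover have "\<Prod>?V \<noteq> 0" using U(1) by simp
  ultimately have "s ^ card ?V = 1" by simp
  moreover have "card U = Suc (card ?V)" using U(1,2) by (metis card.remove)
  ultimately show ?thesis by simp
qed

text \<open>In characteristic 2 with \<open>N\<close> even, the derivative of X^N - X is -1, so all
  roots are simple and there are \<open>N\<close> of them.\<close>

lemma card_power_eq_self:
  assumes "CHAR('k::alg_closed_field) = 2" "even N" "N > 0"
  shows "card {t::'k. t ^ N = t} = N"
proof -
  define p :: "'k poly" where "p = monom 1 N - monom 1 1"
  have N1: "N > 1" using assms(2,3) by auto
  have "degree (monom (1::'k) 1) < degree (monom (1::'k) N)" using N1 by (simp add: degree_monom_eq)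
  then have deg: "degree p = N" unfolding p_def
    using degree_add_eq_left[of "- monom (1::'k) 1" "monom 1 N"] by (simp add: degree_monom_eq)
  then have p0: "p \<noteq> 0" using N1 by auto
  have "(of_nat N :: 'k) = 0" using assms by (simp add: of_nat_eq_0_iff_char_dvd)
  then have pd: "poly (pderiv p) x = -1" for x
    by (simp add: p_def pderiv_diff pderiv_monom)
  obtain A where A: "size A = degree p" "p = smult (lead_coeff p) (\<Prod>x\<in>#A. [:-x, 1:])"
    using alg_closed_imp_factorization[OF p0] by blast
  have cnt: "count A x \<le> 1" for x
  proof (rule ccontr)
    assume "\<not> ?thesis"
    then have "{#x, x#} \<subseteq># A" by (auto simp: subseteq_mset_def)
    then obtain B where "A = {#x, x#} + B" by (auto simp: subset_mset.le_iff_add)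
    then have "p = [:-x, 1:] * ([:-x, 1:] * smult (lead_coeff p) (\<Prod>x\<in>#B. [:-x, 1:]))"
      using A(2) by simp
    then obtain r where "p = [:-x, 1:] * ([:-x, 1:] * r)" by blast
    then have "poly (pderiv p) x = 0" by (simp only: pderiv_mult poly_add poly_mult) simp
    with pd show False by simp
  qed
  have "set_mset A = {t. t ^ N = t}"
  proof -
    have "poly p t = 0 \<longleftrightarrow> t \<in># A" for t
      by (subst A(2)) (use p0 in \<open>auto simp: poly_prod_mset prod_mset_zero_iff image_iff\<close>)
    then show ?thesis by (auto simp: p_def poly_monom)
  qed
  moreover have "size A = card (set_mset A)"
  proof -
    have "count A x = 1" if "x \<in># A" for x using cnt[of x] that count_greater_zero_iff[of A x] by linarith
    then show ?thesis by (simp add: size_multiset_overloaded_eq)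
  qed
  ultimately show ?thesis using A(1) deg by simp
qed

lemma poly_eq_sum_multiples:
  fixes p :: "'k::comm_ring_1 poly"
  assumes "\<And>i. coeff p i \<noteq> 0 \<Longrightarrow> M dvd i" "M > 0"
  shows "poly p t = (\<Sum>j\<le>degree p div M. coeff p (M * j) * t ^ (M * j))"
proof -
  have "poly p t = (\<Sum>i\<in>(*) M ` {..degree p div M}. coeff p i * t ^ i)"
    unfolding poly_altdef
  proof (rule sum.mono_neutral_right)
    show "(*) M ` {..degree p div M} \<subseteq> {..degree p}"
      using assms(2) by (auto simp: less_eq_div_iff_mult_less_eq mult.commute)
    show "\<forall>i\<in>{..degree p} - (*) M ` {..degree p div M}. coeff p i * t ^ i = 0"
    proof safe
      fix i assume i: "i \<le> degree p" "i \<notin> (*) M ` {..degree p div M}"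
      have "coeff p i = 0"
      proof (rule ccontr)
        assume "coeff p i \<noteq> 0"
        then obtain j where "i = M * j" using assms(1) by auto
        with i assms(2) show False by (auto simp: less_eq_div_iff_mult_less_eq mult.commute)
      qed
      then show "coeff p i * t ^ i = 0" by simp
    qed
  qed auto
  also have "\<dots> = (\<Sum>j\<le>degree p div M. coeff p (M * j) * t ^ (M * j))"
    by (subst sum.reindex) (use assms(2) in \<open>auto simp: inj_on_def\<close>)
  finally show ?thesis .
qed

lemma dvd_of_poly_power:
  fixes p g :: "'k::alg_closed_field poly"
  assumes "\<And>t. poly p t = poly g (t ^ m)" "coeff p i \<noteq> 0" shows "m dvd i"
proof -
  have "p = (\<Sum>j\<le>degree g. monom (coeff g j) (m * j))"
    by (rule poly_eqI_alg_closed) (simp add: assms(1) poly_altdef[of g] poly_sum poly_monom power_mult)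
  then have "coeff p i = (\<Sum>j\<le>degree g. if m * j = i then coeff g j else 0)"
    by (simp add: coeff_sum coeff_monom)
  from assms(2)[unfolded this] obtain j where "(if m * j = i then coeff g j else 0) \<noteq> 0"
    by (rule sum.not_neutral_contains_not_neutral)
  then have "m * j = i" by (rule contrapos_np) simp
  then show ?thesis by auto
qed

text \<open>Comparing coefficients gives \<open>a ^ i = 1\<close> on \<open>S\<close>. With
  \<open>r\<close> the remainder of \<open>i\<close> modulo \<open>card S\<close>, all elements of
  \<open>S\<close> are roots of X^r - 1, which is possible only for \<open>r = 0\<close>.\<close>

lemma dvd_of_scale_invariant:
  fixes p :: "'k::alg_closed_field poly"
  assumes "finite S" "S \<noteq> {}" "0 \<notin> S" "\<And>a. a \<in> S \<Longrightarrow> a ^ card S = 1"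
    and "\<And>a t. a \<in> S \<Longrightarrow> poly p (a * t) = poly p t" and "coeff p i \<noteq> 0"
  shows "card S dvd i"
proof -
  define r where "r = i mod card S"
  have c: "card S > 0" using assms(1,2) by (simp add: card_gt_0_iff)
  have "a ^ r = 1" if "a \<in> S" for a
  proof -
    have "pcompose p [:0, a:] = p"
      by (rule poly_eqI_alg_closed) (simp add: poly_pcompose assms(5)[OF that] mult.commute[of _ a])
    then have "coeff p i = a ^ i * coeff p i"
      by (metis coeff_pcompose_linear)
    then have "a ^ i = 1" using assms(6) by simp
    moreover have "a ^ i = a ^ (card S * (i div card S)) * a ^ r"
      unfolding r_def by (simp flip: power_add)
    ultimately show ?thesis by (simp add: power_mult assms(4)[OF that])
  qed
  then have *: "S \<subseteq> {x. poly (monom 1 r - 1) x = 0}" by (auto simp: poly_monom)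
  have "r = 0"
  proof (rule ccontr)
    assume "r \<noteq> 0"
    have "coeff (monom (1::'k) r - 1) r = 1" using \<open>r \<noteq> 0\<close> by simp
    then have nz: "monom (1::'k) r - 1 \<noteq> 0" by (metis coeff_0 zero_neq_one)
    have "card S \<le> card {x. poly (monom (1::'k) r - 1) x = 0}"
      by (rule card_mono[OF poly_roots_finite[OF nz] *])
    also have "\<dots> \<le> degree (monom (1::'k) r - 1)" by (rule card_poly_roots_bound[OF nz])
    also have "\<dots> \<le> r" by (rule degree_diff_le) (auto simp: degree_monom_le)
    also have "r < card S" unfolding r_def using c by simp
    finally show False by simp
  qed
  then show ?thesis unfolding r_def by auto
qed

text \<open>Inversion permutes \<open>S\<close>, so the product is its own inverse; in
  characteristic 2 the only square root of 1 is 1.\<close>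

lemma prod_inverse_closed:
  fixes S :: "'k::field set"
  assumes "CHAR('k) = 2" "finite S" "0 \<notin> S" "\<And>s. s \<in> S \<Longrightarrow> inverse s \<in> S"
  shows "\<Prod>S = 1"
proof -
  have "\<Prod>S = (\<Prod>s\<in>S. inverse s)"
    by (rule prod.reindex_bij_witness[of _ inverse inverse]) (auto simp: assms(4))
  then have "\<Prod>S = inverse (\<Prod>S)" using prod_inversef[of id S] by (simp add: o_def)
  moreover have "\<Prod>S \<noteq> 0" using assms(2,3) by simp
  ultimately have "\<Prod>S * \<Prod>S = 1" by (metis right_inverse)
  then show ?thesis using uminus_CHAR_2[OF assms(1)] by (simp add: square_eq_1_iff)
qed

section \<open>Invariants of \<open>SL\<^sub>2(F)\<close> twisted by the cocycle\<close>

text \<open>The value at \<open>(\<tau>, 1)\<close> of the binary quadratic form y X^2 + c z^e X Y +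
  x Y^2. Its value at the point at infinity \<open>(1, 0)\<close> is \<open>y\<close>, the extra
  factor in \<open>f2\<close>.\<close>

definition form :: "'k::field \<Rightarrow> nat \<Rightarrow> 'k \<Rightarrow> 'k \<Rightarrow> 'k \<Rightarrow> 'k \<Rightarrow> 'k" where
  "form c e \<tau> x y z = x + \<tau>\<^sup>2 * y + \<tau> * (c * z ^ e)"

locale char2_subfield =
  fixes F :: "'k::alg_closed_field set" and n e :: nat
  assumes char2: "CHAR('k) = 2" and n: "n > 1" and e: "e > 0"
    and F_0: "0 \<in> F" and F_1: "1 \<in> F"
    and F_add: "\<And>a b. a \<in> F \<Longrightarrow> b \<in> F \<Longrightarrow> a + b \<in> F"
    and F_mult: "\<And>a b. a \<in> F \<Longrightarrow> b \<in> F \<Longrightarrow> a * b \<in> F"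
    and F_inverse: "\<And>a. a \<in> F \<Longrightarrow> inverse a \<in> F"
    and card_F: "card F = 2 ^ n"
begin

definition q :: nat where "q = 2 ^ n"

text \<open>The field with \<open>q\<^sup>2\<close> elements without \<open>F\<close>.\<close>

definition T :: "'k set" where "T = {\<tau>. \<tau> ^ (q * q) = \<tau> \<and> \<tau> ^ q \<noteq> \<tau>}"

definition f2 :: "'k \<Rightarrow> 'k \<Rightarrow> 'k \<Rightarrow> 'k \<Rightarrow> 'k" where
  "f2 c x y z = y * (\<Prod>\<tau>\<in>F. form c e \<tau> x y z)"

definition f3 :: "'k \<Rightarrow> 'k \<Rightarrow> 'k \<Rightarrow> 'k \<Rightarrow> 'k" where
  "f3 c x y z = (\<Prod>\<tau>\<in>T. form c e \<tau> x y z)"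

text \<open>Invariance under generators of SL2 over \<open>F\<close> only: unipotent elements with
  their cocycle, the Weyl element and the torus. For \<open>c = 0\<close> this is the ordinary
  linear action.\<close>

definition inv_fun :: "'k \<Rightarrow> ('k \<Rightarrow> 'k \<Rightarrow> 'k \<Rightarrow> 'k) \<Rightarrow> bool" where
  "inv_fun c P \<longleftrightarrow>
     (\<forall>s\<in>F. \<forall>x y z. P (x + s\<^sup>2 * y + s * (c * z ^ e)) y z = P x y z) \<and>
     (\<forall>x y z. P y x z = P x y z) \<and>
     (\<forall>a\<in>F - {0}. \<forall>x y z. P (a * x) (y / a) z = P x y z)"

lemma inv_funD:
  assumes "inv_fun c P"
  shows "s \<in> F \<Longrightarrow> P (x + s\<^sup>2 * y + s * (c * z ^ e)) y z = P x y z"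
    and "P y x z = P x y z"
    and "a \<in> F - {0} \<Longrightarrow> P (a * x) (y / a) z = P x y z"
  using assms unfolding inv_fun_def by blast+

section \<open>Arithmetic of \<open>F\<close> and \<open>T\<close>\<close>

lemma two_eq_0: "(2::'k) = 0"
  using of_nat_CHAR[where 'a = 'k] by (simp add: char2)

lemma square_add: "(a + b)\<^sup>2 = a\<^sup>2 + (b::'k)\<^sup>2"
  by (simp add: power2_sum two_eq_0)

lemmas minus2 = minus_CHAR_2[OF char2] and uminus2 = uminus_CHAR_2[OF char2]

lemma add_self: "a + a = (0::'k)"
  using minus2[of a a] by simp

lemma q_pos: "q > 1"
  unfolding q_def using n by (intro one_less_power) auto

lemma finite_F: "finite F"
  using card_F by (metis card.infinite power_not_zero zero_neq_numeral)

lemma F_power_q: "s \<in> F \<Longrightarrow> s ^ q = s"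
  using power_card_eq_self[OF finite_F F_0, of s] F_mult q_pos
  by (cases "s = 0") (auto simp: card_F q_def)

lemma power_q_add: "(a + b) ^ q = a ^ q + (b::'k) ^ q"
  by (rule freshmans_dream'[of _ n]) (simp_all add: char2 q_def)

lemma power_qq_add: "(a + b) ^ (q * q) = a ^ (q * q) + (b::'k) ^ (q * q)"
  by (simp add: power_mult power_q_add)

text \<open>Surjectivity of the Frobenius map on \<open>F\<close>. It shows that the unipotent
  generators, parametrised by squares, exhaust all unipotent matrices of their shape.\<close>

lemma F_square_root: assumes "u \<in> F" shows "\<exists>s\<in>F. u = s\<^sup>2"
proof
  have pow: "u ^ m \<in> F" for m by (induction m) (auto intro: F_1 F_mult assms)
  show "u ^ (2 ^ (n - 1)) \<in> F" by (rule pow)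
  have "2 ^ (n - 1) * 2 = q" unfolding q_def using n by (metis mult.commute power_minus_mult less_trans zero_less_one)
  then show "u = (u ^ (2 ^ (n - 1)))\<^sup>2" using F_power_q[OF assms] by (simp flip: power_mult)
qed

text \<open>The roots of X^(q q) - X include those of X^q - X, and both polynomials are
  separable.\<close>

lemma card_T: "card T = q * q - q"
proof -
  have "even q" using n by (simp add: q_def)
  then have c: "card {t::'k. t ^ (q * q) = t} = q * q" "card {t::'k. t ^ q = t} = q"
    using card_power_eq_self[OF char2] q_pos by simp_all
  have T: "T = {t. t ^ (q * q) = t} - {t. t ^ q = t}" by (auto simp: T_def)
  have sub: "{t::'k. t ^ q = t} \<subseteq> {t. t ^ (q * q) = t}" by (auto simp: power_mult)
  have "finite {t::'k. t ^ q = t}" using c(2) q_pos by (intro card_ge_0_finite) auto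
  then show ?thesis unfolding T by (subst card_Diff_subset[OF _ sub]) (simp_all add: c)
qed

lemma card_T_pos: "card T > 0"
  using q_pos by (simp add: card_T)

lemma finite_T: "finite T"
  using card_T_pos by (rule card_ge_0_finite)

lemma T_add: "\<tau> \<in> T \<Longrightarrow> s \<in> F \<Longrightarrow> \<tau> + s \<in> T"
  by (auto simp: T_def power_q_add power_qq_add F_power_q power_mult)

lemma T_mult: assumes "\<tau> \<in> T" "s \<in> F" "s \<noteq> 0" shows "s * \<tau> \<in> T"
  using assms by (auto simp: T_def power_mult_distrib F_power_q power_mult)

lemma T_nz: "0 \<notin> T"
  using q_pos by (simp add: T_def)

lemma T_inverse: "\<tau> \<in> T \<Longrightarrow> inverse \<tau> \<in> T"
  by (auto simp: T_def power_inverse)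

lemma F_power: "s \<in> F - {0} \<Longrightarrow> s ^ (q - 1) = 1"
  using F_power_q[of s] q_pos power_minus_mult[of q s] by auto

section \<open>The deformed Dickson invariants\<close>

lemma form_translate:
  "form c e \<tau> (x + s\<^sup>2 * y + s * (c * z ^ e)) y z = form c e (\<tau> + (s::'k)) x y z"
  by (simp add: form_def square_add algebra_simps)

text \<open>The generators act on the projective parameter: translations send \<open>\<tau>\<close>
  to \<open>\<tau> + s\<close>, the swap to its inverse up to the factor \<tau>^2, the torus to
  \<open>\<tau> / a\<close> up to the factor \<open>a\<close>.\<close>

lemma form_swap: "\<tau> \<noteq> 0 \<Longrightarrow> form c e \<tau> y x z = \<tau>\<^sup>2 * form c e (inverse \<tau>) x y z"
  by (simp add: form_def field_simps power2_eq_square)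

lemma form_scale: "a \<noteq> 0 \<Longrightarrow> form c e \<tau> (a * x) (y / a) z = a * form c e (\<tau> / a) x y z"
  by (simp add: form_def field_simps power2_eq_square)

lemma prod_form_translate:
  assumes "\<And>\<tau>. \<tau> \<in> S \<Longrightarrow> \<tau> + (s::'k) \<in> S"
  shows "(\<Prod>\<tau>\<in>S. form c e \<tau> (x + s\<^sup>2 * y + s * (c * z ^ e)) y z) = (\<Prod>\<tau>\<in>S. form c e \<tau> x y z)"
  unfolding form_translate
  by (rule prod.reindex_bij_witness[of _ "\<lambda>u. u + s" "\<lambda>u. u + s"])
    (simp_all add: assms add.assoc add_self)

text \<open>The factors \<tau>^2 multiply to the square of the product of \<open>S\<close>, which is
  1 by \<open>prod_inverse_closed\<close>.\<close>

lemma prod_form_swap: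
  assumes "finite S" "(0::'k) \<notin> S" "\<And>\<tau>. \<tau> \<in> S \<Longrightarrow> inverse \<tau> \<in> S"
  shows "(\<Prod>\<tau>\<in>S. form c e \<tau> y x z) = (\<Prod>\<tau>\<in>S. form c e \<tau> x y z)"
proof -
  have "(\<Prod>\<tau>\<in>S. form c e \<tau> y x z) = (\<Prod>\<tau>\<in>S. \<tau>\<^sup>2 * form c e (inverse \<tau>) x y z)"
    by (rule prod.cong[OF refl form_swap]) (use assms(2) in auto)
  also have "\<dots> = (\<Prod>S)\<^sup>2 * (\<Prod>\<tau>\<in>S. form c e (inverse \<tau>) x y z)"
    by (simp add: prod.distrib prod_power_distrib)
  also have "(\<Prod>\<tau>\<in>S. form c e (inverse \<tau>) x y z) = (\<Prod>\<tau>\<in>S. form c e \<tau> x y z)"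
    by (rule prod.reindex_bij_witness[of _ inverse inverse]) (simp_all add: assms(3))
  finally show ?thesis using prod_inverse_closed[OF char2 assms] by simp
qed

lemma prod_form_scale:
  assumes "a \<in> F - {0}" "\<And>\<tau> s. \<tau> \<in> S \<Longrightarrow> s \<in> F - {0} \<Longrightarrow> s * \<tau> \<in> S"
  shows "(\<Prod>\<tau>\<in>S. form c e \<tau> (a * x) (y / a) z) = a ^ card S * (\<Prod>\<tau>\<in>S. form c e \<tau> x y z)"
proof -
  have a: "a \<noteq> 0" "inverse a \<in> F - {0}" using assms(1) F_inverse by auto
  have "(\<Prod>\<tau>\<in>S. form c e (\<tau> / a) x y z) = (\<Prod>\<tau>\<in>S. form c e \<tau> x y z)"
    by (rule prod.reindex_bij_witness[of _ "\<lambda>u. a * u" "\<lambda>u. inverse a * u"])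
      (use assms(2)[OF _ assms(1)] assms(2)[OF _ a(2)] a(1) in \<open>simp_all add: field_simps\<close>)
  then show ?thesis by (simp add: form_scale[OF a(1)] prod.distrib)
qed

lemma f3_inv: "inv_fun c (f3 c)"
  unfolding inv_fun_def
proof (intro conjI ballI allI)
  fix s x y z assume "s \<in> F"
  then show "f3 c (x + s\<^sup>2 * y + s * (c * z ^ e)) y z = f3 c x y z"
    unfolding f3_def by (intro prod_form_translate T_add)
next
  show "f3 c y x z = f3 c x y z" for x y z
    unfolding f3_def by (rule prod_form_swap[OF finite_T T_nz T_inverse])
next
  fix a x y z assume a: "a \<in> F - {0}"
  \<comment> \<open>The torus element contributes the factor \<open>a ^ card T\<close>, trivial
    because \<open>q - 1\<close> divides \<open>card T\<close>.\<close>
  have "card T = (q - 1) * q" by (simp add: card_T algebra_simps)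
  then have "a ^ card T = 1" by (simp only: power_mult F_power[OF a] power_one)
  then show "f3 c (a * x) (y / a) z = f3 c x y z"
    unfolding f3_def by (subst prod_form_scale[OF a]) (use T_mult in auto)
qed

lemma f2_inv: "inv_fun c (f2 c)"
  unfolding inv_fun_def
proof (intro conjI ballI allI)
  fix s x y z assume "s \<in> F"
  then show "f2 c (x + s\<^sup>2 * y + s * (c * z ^ e)) y z = f2 c x y z"
    unfolding f2_def by (subst prod_form_translate) (auto intro: F_add)
next
  \<comment> \<open>The swap exchanges the points 0 and infinity of the projective line, where the
    form takes the values \<open>x\<close> and \<open>y\<close>; the other points are permuted by
    inversion.\<close>
  have *: "f2 c x y z = x * y * (\<Prod>\<tau>\<in>F-{0}. form c e \<tau> x y z)" for x y z
    unfolding f2_def by (subst prod.remove[OF finite_F F_0]) (simp add: form_def)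
  show "f2 c y x z = f2 c x y z" for x y z
    unfolding * by (subst prod_form_swap) (use finite_F F_inverse in auto)
next
  fix a x y z assume a: "a \<in> F - {0}"
  \<comment> \<open>The scalar \<open>a ^ q = a\<close> from the product cancels against the factor
    \<open>y / a\<close>.\<close>
  then show "f2 c (a * x) (y / a) z = f2 c x y z"
    unfolding f2_def
    by (subst prod_form_scale[OF a]) (use F_mult F_power_q[of a] in \<open>auto simp: card_F q_def\<close>)
qed

text \<open>With weights \<open>e\<close>, \<open>e\<close>, \<open>1\<close> all three terms of the
  form have degree \<open>e\<close>. These are the degrees of the functions on \<open>V\<close> that
  are later inserted for the variables.\<close>

lemma wpol_form: "wpol e e 1 (int e) (form (c::'b::field) e \<tau>)"
proof -
  have "wpol e e 1 1 (\<lambda>x y z. z :: 'b)" by (rule wpol.thd) simp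
  from wpol_power[OF this, of e] have "wpol e e 1 (int e) (\<lambda>x y z. z ^ e :: 'b)" by simp
  then show ?thesis
    unfolding form_def by (intro wpol.add wpol_scale wpol.fst wpol.snd) auto
qed

lemma wpol_f2: "wpol e e 1 (int (e + e * q)) (f2 c)"
  unfolding f2_def
  by (rule wpol_mult_le[OF wpol.snd wpol_prod[OF wpol_form]]) (auto simp: card_F q_def)

lemma wpol_f3: "wpol e e 1 (int (e * card T)) (f3 c)"
  unfolding f3_def using wpol_prod[OF wpol_form, of T "\<lambda>\<tau>. c"] by simp

text \<open>On \<open>z = 0\<close> the deformation disappears, since \<open>e > 0\<close>. The
  \<open>z\<close> on the right is arbitrary because the form with \<open>c = 0\<close> does not
  involve it.\<close>

lemma form_z0: "form c e \<tau> x y 0 = form 0 e \<tau> x y z"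
  using e by (simp add: form_def)

lemma f2_z0: "f2 c x y 0 = f2 0 x y z"
  by (simp only: f2_def form_z0[of c _ x y z])

lemma f3_z0: "f3 c x y 0 = f3 0 x y z"
  by (simp only: f3_def form_z0[of c _ x y z])

lemma f3_axis: "f3 0 x 0 z = x ^ card T"
  by (simp add: f3_def form_def)

lemma f2_axis: "f2 c x 0 z = 0"
  by (simp add: f2_def)

lemma f2_ne_0: "\<exists>x. f2 c x 1 z \<noteq> 0"
proof -
  obtain x where "(\<Prod>\<tau>\<in>F. x + (\<tau>\<^sup>2 * 1 + \<tau> * (c * z ^ e))) \<noteq> 0"
    using prod_linear_ne_0[OF finite_F] by metis
  then show ?thesis by (auto simp: f2_def form_def add.assoc)
qed

lemma polyfun_f2: "polyfun (f2 c)" by (rule wpol_imp_polyfun[OF wpol_f2])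
lemma polyfun_f3: "polyfun (f3 c)" by (rule wpol_imp_polyfun[OF wpol_f3])

text \<open>Squaring permutes \<open>F\<close>, so the undeformed \<open>f2\<close> is the product
  of one linear form for each point of the projective line over \<open>F\<close>.\<close>

lemma f2_0_linear_factors: "f2 0 x y z = y * (\<Prod>u\<in>F. x - u * y)"
proof -
  have inj: "inj_on (\<lambda>s. s\<^sup>2) F"
  proof (rule inj_onI)
    fix s t :: 'k assume "s\<^sup>2 = t\<^sup>2"
    then have "(s + t)\<^sup>2 = 0" by (simp add: square_add add_self)
    then show "s = t" using uminus2 by (simp add: add_eq_0_iff2)
  qed
  have "(\<lambda>s. s\<^sup>2) ` F = F"
    by (rule endo_inj_surj[OF finite_F _ inj]) (auto intro: F_mult simp: power2_eq_square)
  then have "(\<Prod>u\<in>F. x - u * y) = (\<Prod>s\<in>F. x - s\<^sup>2 * y)"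
    using prod.reindex[OF inj, of "\<lambda>u. x - u * y"] by simp
  then show ?thesis by (simp add: f2_def form_def minus2)
qed

section \<open>Generation of the invariants by \<open>z\<close>, \<open>f2\<close> and
  \<open>f3\<close>\<close>

lemma inv_fun_comp:
  assumes "inv_fun c A" "inv_fun c B"
  shows "inv_fun c (\<lambda>x y z. h z (A x y z) (B x y z))"
  unfolding inv_fun_def
  using inv_funD[OF assms(1)] inv_funD[OF assms(2)] by (intro conjI ballI allI arg_cong2[where f = "h _"]) blast+

lemma inv_fun_diff: "inv_fun c A \<Longrightarrow> inv_fun c B \<Longrightarrow> inv_fun c (\<lambda>x y z. A x y z - B x y z)"
  by (rule inv_fun_comp)

text \<open>A quotient of invariants is invariant: \<open>A\<close> can be cancelled. The claim
  \<open>main\<close> treats the three kinds of generators uniformly, as substitutions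
  \<open>(g1, g2)\<close>.\<close>

lemma inv_fun_quotient:
  assumes A: "inv_fun c A" "polyfun A" "A x0 y0 z0 \<noteq> 0"
    and B: "inv_fun c B" and C: "polyfun C" and B_eq: "\<And>x y z. B x y z = A x y z * C x y z"
  shows "inv_fun c C"
proof -
  have main: "C (g1 x y z) (g2 x y z) z = C x y z"
    if "polyfun g1" "polyfun g2" "\<And>x y z. A (g1 x y z) (g2 x y z) z = A x y z"
      "\<And>x y z. B (g1 x y z) (g2 x y z) z = B x y z" for g1 g2 x y z
  proof (rule polyfun_cancel[where h = A and f = "\<lambda>x y z. C (g1 x y z) (g2 x y z) z" and g = C,
        OF A(2) _ C _ A(3)])
    show "polyfun (\<lambda>x y z. C (g1 x y z) (g2 x y z) z)"
      by (intro polyfun_subst[OF C] that wpol.thd) simp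
    show "A x y z * C (g1 x y z) (g2 x y z) z = A x y z * C x y z" for x y z
      using that(3)[of x y z] that(4)[of x y z] B_eq[of x y z] B_eq[of "g1 x y z" "g2 x y z" z] by metis
  qed
  have zp: "polyfun (\<lambda>x y z. z ^ e :: 'k)"
    using wpol_power[of 0 0 0 0 "\<lambda>x y z. z" e] by (simp add: wpol.thd)
  show ?thesis
    unfolding inv_fun_def
  proof (intro conjI ballI allI)
    fix s x y z assume s: "s \<in> F"
    show "C (x + s\<^sup>2 * y + s * (c * z ^ e)) y z = C x y z"
      by (rule main[of "\<lambda>x y z. x + s\<^sup>2 * y + s * (c * z ^ e)" "\<lambda>x y z. y"])
        (intro inv_funD[OF A(1)] inv_funD[OF B] s wpol.add wpol_scale wpol.fst wpol.snd zp | simp)+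
  next
    show "C y x z = C x y z" for x y z
      by (rule main[of "\<lambda>x y z. y" "\<lambda>x y z. x"])
        (simp_all add: wpol.fst wpol.snd inv_funD(2)[OF A(1)] inv_funD(2)[OF B])
  next
    fix a x y z assume a: "a \<in> F - {0}"
    have p: "polyfun (\<lambda>x y z. y / a)"
      using wpol_scale[OF wpol.snd[of 0 0 0 0], of "inverse a"] by (simp add: field_simps)
    show "C (a * x) (y / a) z = C x y z"
      by (rule main[of "\<lambda>x y z. a * x" "\<lambda>x y z. y / a"])
        (intro inv_funD[OF A(1)] inv_funD[OF B] a p wpol_scale wpol.fst order_refl | simp)+
  qed
qed

text \<open>On the axis only powers of \<open>x ^ card T\<close> survive, so the restriction can be
  matched by a polynomial in \<open>f3\<close>. The unipotent elements make the exponents divisible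
  by \<open>q\<close>, the torus by \<open>q - 1\<close>, and these are coprime with product
  \<open>card T\<close>.\<close>

lemma inv_fun_axis_sum:
  assumes P: "wpol e e 1 d P" "inv_fun 0 P"
  obtains b J where "\<And>x. P x 0 0 = (\<Sum>j\<le>J. b j * x ^ (card T * j))"
    "\<And>j. j \<le> J \<Longrightarrow> b j \<noteq> 0 \<Longrightarrow> int (e * (card T * j)) \<le> d"
proof -
  obtain p where p: "\<And>t. P t 0 0 = poly p t" "p \<noteq> 0 \<Longrightarrow> int (e * degree p) \<le> d"
    using wpol_axis_poly[OF P(1)] by blast
  have trans: "P (x + u * y) y z = P x y z" if "u \<in> F" for u x y z
  proof -
    obtain s where s: "s \<in> F" "u = s\<^sup>2" using F_square_root[OF \<open>u \<in> F\<close>] by blast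
    show ?thesis using inv_funD(1)[OF P(2) s(1), of x y z] s(2) by simp
  qed
  have "\<exists>G. polyfun G \<and> (\<forall>x y z. P x y z = G (\<Prod>u\<in>F. x + u * y) y z)"
    by (rule translation_invariant[of F "\<lambda>y z. y" 1 0,
          OF finite_F F_0 F_add _ _ _ wpol_imp_polyfun[OF P(1)] trans])
      (simp_all add: uminus2 wpol.snd)
  then obtain G where G: "polyfun G" "\<And>x y z. P x y z = G (\<Prod>u\<in>F. x + u * y) y z" by blast
  obtain g where g: "\<And>t. G t 0 0 = poly g t"
    using wpol_axis_poly[OF G(1)] by blast
  \<comment> \<open>On the axis \<open>y = 0\<close> the orbit product over \<open>F\<close>
    collapses to \<open>x ^ q\<close>.\<close>
  have pg: "poly p t = poly g (t ^ q)" for t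
    using G(2)[of t 0 0] p(1)[of t] g[of "t ^ q"] by (simp add: card_F q_def)
  have M: "card T = (q - 1) * q" by (simp add: card_T algebra_simps)
  have dvd: "card T dvd i" if "coeff p i \<noteq> 0" for i
  proof -
    have "q dvd i" by (rule dvd_of_poly_power[OF pg that])
    moreover have "card (F - {0}) dvd i"
    proof (rule dvd_of_scale_invariant[OF _ _ _ _ _ that])
      show "finite (F - {0})" "F - {0} \<noteq> {}" "0 \<notin> F - {0}" using finite_F F_1 by auto
      have cq: "card (F - {0}) = q - 1" using finite_F F_0 by (simp add: card_F q_def)
      show "a ^ card (F - {0}) = 1" if "a \<in> F - {0}" for a
        unfolding cq by (rule F_power[OF that])
      show "poly p (a * t) = poly p t" if "a \<in> F - {0}" for a t
        using inv_funD(3)[OF P(2) that, of t 0 0] by (simp add: p(1))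
    qed
    moreover have "card (F - {0}) = q - 1" using finite_F F_0 by (simp add: card_F q_def)
    moreover have "coprime (q - 1) q" using q_pos coprime_diff_one_left_nat by simp
    ultimately show ?thesis unfolding M by (simp add: divides_mult)
  qed
  show ?thesis
  proof
    show "P x 0 0 = (\<Sum>j\<le>degree p div card T. coeff p (card T * j) * x ^ (card T * j))" for x
      unfolding p(1) by (rule poly_eq_sum_multiples[OF dvd card_T_pos])
    fix j assume "coeff p (card T * j) \<noteq> 0"
    then have "card T * j \<le> degree p" "p \<noteq> 0" by (auto intro: le_degree)
    then have "int (e * (card T * j)) \<le> int (e * degree p)" by (metis mult_le_mono2 of_nat_le_iff)
    with p(2)[OF \<open>p \<noteq> 0\<close>] show "int (e * (card T * j)) \<le> d" by linarith
  qed
qed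

text \<open>The zero locus spreads over all lines defined over \<open>F\<close>: the swap carries
  \<open>y = 0\<close> to \<open>x = 0\<close>, and the unipotent elements carry this to every
  \<open>x = u * y\<close>. The corresponding linear forms multiply to \<open>f2 0\<close>.\<close>

lemma inv_fun_vanish_axis:
  assumes P: "wpol e e 1 d P" "inv_fun 0 P" and van: "\<And>x z. P x 0 z = 0"
  obtains P' where "wpol e e 1 (d - int (e + e * q)) P'" "inv_fun 0 P'"
    "\<And>x y z. P x y z = f2 0 x y z * P' x y z"
proof -
  obtain h where h: "wpol e e 1 (d - int e) h" "\<And>x y z. P x y z = y * h x y z"
    using wpol_split_snd[OF P(1)] van by auto
  have zero: "P (u * y) y z = 0" if "u \<in> F" for u y z
  proof -
    obtain s where s: "s \<in> F" "u = s\<^sup>2" using F_square_root[OF \<open>u \<in> F\<close>] by blast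
    have "P (0 + s\<^sup>2 * y + s * (0 * z ^ e)) y z = P 0 y z" by (rule inv_funD(1)[OF P(2) s(1)])
    also have "\<dots> = P y 0 z" by (rule inv_funD(2)[OF P(2)])
    finally show ?thesis using s(2) van by simp
  qed
  have hz: "h (u * y) y z = 0" if "u \<in> F" for u y z
  proof (rule polyfun_mult_eq_0[where f = "\<lambda>x y z. y" and g = "\<lambda>x y z. h (u * y) y z"])
    show "polyfun (\<lambda>x y z. y :: 'k)" by (rule wpol.snd) simp
    show "polyfun (\<lambda>x y z. h (u * y) y z)"
      by (intro polyfun_subst[OF wpol_imp_polyfun[OF h(1)]] wpol_scale wpol.snd wpol.thd) auto
    show "y * h (u * y) y z = 0" for y z using zero[OF that] h(2) by metis
    show "(1::'k) \<noteq> 0" by simp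
  qed
  have wy: "wpol e e 1 (int e) (\<lambda>x y z. y :: 'k)" by (rule wpol.snd) simp
  obtain P' where P': "wpol e e 1 (d - int e - int (e * card F)) P'"
    "\<And>x y z. h x y z = (\<Prod>u\<in>F. x - u * y) * P' x y z"
    using wpol_dvd_prod[of F e e 1 "\<lambda>y z. y" 1 1, OF finite_F wy one_neq_zero h(1) hz]
    by blast
  have eq: "P x y z = f2 0 x y z * P' x y z" for x y z
    using h(2)[of x y z] P'(2)[of x y z] by (simp add: f2_0_linear_factors)
  obtain x0 where x0: "f2 0 x0 1 0 \<noteq> 0" using f2_ne_0 by blast
  show ?thesis
  proof
    show "wpol e e 1 (d - int (e + e * q)) P'" using P'(1) by (simp add: card_F q_def algebra_simps)
    show "inv_fun 0 P'"
      by (rule inv_fun_quotient[OF f2_inv polyfun_f2 x0 P(2) wpol_imp_polyfun[OF P'(1)] eq])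
  qed (rule eq)
qed

text \<open>Dickson's theorem for \<open>SL\<^sub>2(F)\<close>, with the result expressed through the deformed invariants and a
  degree bound for them, so that it can be subtracted in the induction on the degree.\<close>

lemma dickson_lift:
  assumes "wpol e e 1 d P" "inv_fun 0 P" "\<And>x y z. P x y z = P x y 0"
  shows "\<exists>Q. polyfun Q \<and> wpol e e 1 d (\<lambda>x y z. Q 0 (f2 c x y z) (f3 c x y z)) \<and>
    (\<forall>x y z. Q 0 (f2 0 x y z) (f3 0 x y z) = P x y z)"
  using assms
proof (induction "nat (d + 1)" arbitrary: d P rule: less_induct)
  case less
  show ?case
  proof (cases "d < 0")
    case True
    then have "P x y z = 0" for x y z by (rule wpol_neg[OF less.prems(1)])
    then show ?thesis by (intro exI[of _ "\<lambda>a b t. 0"]) (auto intro: wpol.zero)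
  next
    case False
    obtain b J where bJ: "\<And>x. P x 0 0 = (\<Sum>j\<le>J. b j * x ^ (card T * j))"
      "\<And>j. j \<le> J \<Longrightarrow> b j \<noteq> 0 \<Longrightarrow> int (e * (card T * j)) \<le> d"
      using inv_fun_axis_sum[OF less.prems(1,2)] by blast
    \<comment> \<open>\<open>S\<close> is the polynomial for which \<open>P\<close> equals
      \<open>S (f3 0 x y z)\<close> on the axis. The bound on the exponents keeps \<open>S\<close>
      of the deformed \<open>f3\<close> within degree \<open>d\<close>.\<close>
    define S where "S = (\<lambda>t. \<Sum>j\<le>J. b j * t ^ j)"
    have wS: "wpol e e 1 d (\<lambda>x y z. S (f3 c x y z))" for c
      unfolding S_def
    proof (rule wpol_sum)
      fix j assume "j \<in> {..J}"
      show "wpol e e 1 d (\<lambda>x y z. b j * f3 c x y z ^ j)"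
      proof (cases "b j = 0")
        case True
        then show ?thesis by (simp add: wpol.zero)
      next
        case False
        then have "int (e * card T) * int j \<le> d" using bJ(2) \<open>j \<in> {..J}\<close> by (simp add: mult.assoc)
        then show ?thesis by (intro wpol_scale wpol_mono[OF wpol_power[OF wpol_f3]])
      qed
    qed
    have pS: "polyfun (\<lambda>x y z. S z)"
      unfolding S_def
    proof (rule wpol_sum)
      fix j
      have "polyfun (\<lambda>x y z. z :: 'k)" by (rule wpol.thd) simp
      from wpol_power[OF this, of j] show "polyfun (\<lambda>x y z. b j * z ^ j)" by (simp add: wpol_scale)
    qed
    let ?h = "\<lambda>x y z. P x y z - S (f3 0 x y z)"
    have "inv_fun 0 ?h"
      by (rule inv_fun_comp[OF less.prems(2) f3_inv, of "\<lambda>z u v. u - S v"])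
    moreover have "?h x 0 z = 0" for x z
      using less.prems(3)[of x 0 z] bJ(1)[of x] by (simp add: S_def f3_axis power_mult)
    ultimately obtain P' where P': "wpol e e 1 (d - int (e + e * q)) P'" "inv_fun 0 P'"
      "\<And>x y z. ?h x y z = f2 0 x y z * P' x y z"
      using inv_fun_vanish_axis[OF wpol_diff[OF less.prems(1) wS[of 0]]] by blast
    \<comment> \<open>The recursion needs a quotient free of \<open>z\<close>; this follows by
      cancelling \<open>f2 0\<close>, which is itself free of \<open>z\<close>.\<close>
    have P'z: "P' x y z = P' x y 0" for x y z
    proof -
      obtain x0 where x0: "f2 0 x0 1 0 \<noteq> 0" using f2_ne_0 by blast
      have *: "f2 0 x y 0 * P' x y z = f2 0 x y 0 * P' x y 0" for x y z
        using P'(3)[of x y z] P'(3)[of x y 0] less.prems(3)[of x y z]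
          f2_z0[of 0 x y z] f3_z0[of 0 x y z] by simp
      have p: "polyfun P'" by (rule wpol_imp_polyfun[OF P'(1)])
      show ?thesis
      proof (rule polyfun_cancel[where h = "\<lambda>x y z. f2 0 x y 0" and f = P' and
            g = "\<lambda>x y z. P' x y 0", OF _ p _ * x0])
        show "polyfun (\<lambda>x y z. f2 0 x y 0)" "polyfun (\<lambda>x y z. P' x y 0)"
          by (intro polyfun_subst[OF polyfun_f2] polyfun_subst[OF p] wpol.fst wpol.snd wpol.zero; simp)+
      qed
    qed
    have "e + e * q > 0" using e by simp
    then have "int (e + e * q) > 0" by (simp only: of_nat_0_less_iff)
    with False have "nat (d - int (e + e * q) + 1) < nat (d + 1)" by linarith
    from less.hyps[OF this P'(1,2) P'z] obtain Q where Q: "polyfun Q"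
      "wpol e e 1 (d - int (e + e * q)) (\<lambda>x y z. Q 0 (f2 c x y z) (f3 c x y z))"
      "\<And>x y z. Q 0 (f2 0 x y z) (f3 0 x y z) = P' x y z" by blast
    have "polyfun (\<lambda>x y z. S z + y * Q 0 y z)"
      by (intro wpol.add polyfun_mult pS polyfun_subst[OF Q(1)] wpol.snd wpol.thd wpol.zero) auto
    moreover have "wpol e e 1 d (\<lambda>x y z. S (f3 c x y z) + f2 c x y z * Q 0 (f2 c x y z) (f3 c x y z))"
      by (intro wpol.add wS wpol_mult_le[OF wpol_f2 Q(2)]) simp
    moreover have "S (f3 0 x y z) + f2 0 x y z * Q 0 (f2 0 x y z) (f3 0 x y z) = P x y z" for x y z
      using P'(3)[of x y z] Q(3)[of x y z] by (simp add: algebra_simps)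
    ultimately show ?thesis by (intro exI[of _ "\<lambda>x y z. S z + y * Q 0 y z"]) blast
  qed
qed

text \<open>Since \<open>dickson_lift\<close> bounds the degree of the lift by \<open>d\<close>,
  subtracting it from \<open>P\<close> stays within \<open>d\<close>; the remainder vanishes on
  \<open>z = 0\<close>, and its quotient by \<open>z\<close> has degree at most
  \<open>d - 1\<close>.\<close>

lemma inv_fun_imp_generated:
  assumes "polyfun P" "inv_fun c P"
  shows "\<exists>Q. polyfun Q \<and> (\<forall>x y z. P x y z = Q z (f2 c x y z) (f3 c x y z))"
proof -
  have "\<exists>Q. polyfun Q \<and> (\<forall>x y z. P x y z = Q z (f2 c x y z) (f3 c x y z))"
    if "wpol e e 1 d P" "inv_fun c P" for d P
    using that
  proof (induction "nat (d + 1)" arbitrary: d P rule: less_induct)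
    case less
    show ?case
    proof (cases "d < 0")
      case True
      then have "P x y z = 0" for x y z by (rule wpol_neg[OF less.prems(1)])
      then show ?thesis by (intro exI[of _ "\<lambda>a b t. 0"]) (auto intro: wpol.zero)
    next
      case False
      let ?P0 = "\<lambda>x y z. P x y 0"
      have w0: "wpol e e 1 d ?P0"
        by (rule wpol_subst[OF less.prems(1)]) (auto intro: wpol.fst wpol.snd wpol.zero)
      have i0: "inv_fun 0 ?P0"
        unfolding inv_fun_def
      proof (intro conjI ballI allI)
        show "P (x + s\<^sup>2 * y + s * (0 * z ^ e)) y 0 = P x y 0" if "s \<in> F" for s x y z
          using inv_funD(1)[OF less.prems(2) that, of x y 0] e by (simp add: zero_power)
        show "P y x 0 = P x y 0" for x y by (rule inv_funD(2)[OF less.prems(2)])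
        show "P (a * x) (y / a) 0 = P x y 0" if "a \<in> F - {0}" for a x y
          by (rule inv_funD(3)[OF less.prems(2) that])
      qed
      obtain Q where Q: "polyfun Q" "wpol e e 1 d (\<lambda>x y z. Q 0 (f2 c x y z) (f3 c x y z))"
        "\<And>x y z. Q 0 (f2 0 x y z) (f3 0 x y z) = P x y 0"
        using dickson_lift[OF w0 i0 refl] by blast
      let ?R = "\<lambda>x y z. P x y z - Q 0 (f2 c x y z) (f3 c x y z)"
      have "inv_fun c (\<lambda>x y z. Q 0 (f2 c x y z) (f3 c x y z))"
        by (rule inv_fun_comp[OF f2_inv f3_inv])
      with less.prems(2) have iR: "inv_fun c ?R" by (rule inv_fun_diff)
      have wR: "wpol e e 1 d ?R" by (rule wpol_diff[OF less.prems(1) Q(2)])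
      have R0: "?R x y 0 = 0" for x y
        using Q(3)[of x y 0] f2_z0[of c x y 0] f3_z0[of c x y 0] by simp
      obtain P' where P': "wpol e e 1 (d - 1) P'" "\<And>x y z. ?R x y z = z * P' x y z"
        using wpol_split_thd[OF wR] R0 by auto
      have "polyfun (\<lambda>x y z. z :: 'k)" by (rule wpol.thd) simp
      moreover have "inv_fun c (\<lambda>x y z. z)" by (simp add: inv_fun_def)
      ultimately have "inv_fun c P'"
        by (intro inv_fun_quotient[where A = "\<lambda>x y z. z", OF _ _ one_neq_zero iR wpol_imp_polyfun[OF P'(1)] P'(2)])
      moreover have "nat (d - 1 + 1) < nat (d + 1)" using False by simp
      ultimately obtain Q' where Q': "polyfun Q'" "\<And>x y z. P' x y z = Q' z (f2 c x y z) (f3 c x y z)"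
        using less.hyps[OF _ P'(1)] by blast
      have "polyfun (\<lambda>x y z. Q 0 y z + x * Q' x y z)"
        by (intro wpol.add polyfun_mult polyfun_subst[OF Q(1)] Q'(1) wpol.fst wpol.snd wpol.thd wpol.zero) auto
      moreover have "P x y z = Q 0 (f2 c x y z) (f3 c x y z) + z * Q' z (f2 c x y z) (f3 c x y z)" for x y z
        using P'(2)[of x y z] unfolding Q'(2)[of x y z] by (simp add: diff_eq_eq)
      ultimately show ?thesis by (intro exI[of _ "\<lambda>x y z. Q 0 y z + x * Q' x y z"]) blast
    qed
  qed
  with polyfun_imp_wpol[OF assms(1)] assms(2) show ?thesis by blast
qed

text \<open>Two inductions on the degree of the relation. On the axis \<open>f2 0\<close> vanishes
  while \<open>f3 0\<close> takes every value, so a relation between these two is divisible by its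
  variable for \<open>f2\<close>, which cancels. A relation with \<open>z\<close> becomes one of
  those at \<open>z = 0\<close>, hence is divisible by its variable for \<open>z\<close>.\<close>

lemma f2_f3_independent:
  assumes "polyfun Q" "\<And>x y z. Q z (f2 c x y z) (f3 c x y z) = 0"
  shows "Q x y z = 0"
proof -
  have plane: "Q 0 s t = 0"
    if "wpol 1 1 1 d Q" "\<And>x y z. Q 0 (f2 0 x y z) (f3 0 x y z) = 0" for d Q s t
    using that
  proof (induction "nat (d + 1)" arbitrary: d Q s t rule: less_induct)
    case less
    show ?case
    proof (cases "d < 0")
      case True
      then show ?thesis by (rule wpol_neg[OF less.prems(1)])
    next
      case False
      have ax: "Q 0 0 t = 0" for t
      proof -
        obtain x where "x ^ card T = t" using nth_root_exists[OF card_T_pos] by blast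
        with less.prems(2)[of x 0 0] show ?thesis by (simp add: f2_axis f3_axis)
      qed
      obtain g where g: "wpol 1 1 1 (d - 1) g" "\<And>x y z. Q x y z = Q x 0 z + y * g x y z"
        using wpol_split_snd[OF less.prems(1)] by auto
      have Qg: "Q 0 y z = y * g 0 y z" for y z using g(2)[of 0 y z] ax by simp
      obtain x0 where x0: "f2 0 x0 1 0 \<noteq> 0" using f2_ne_0 by blast
      have "g 0 (f2 0 x y z) (f3 0 x y z) = 0" for x y z
      proof (rule polyfun_mult_eq_0[where f = "f2 0" and g = "\<lambda>x y z. g 0 (f2 0 x y z) (f3 0 x y z)",
            OF polyfun_f2 _ _ x0])
        show "polyfun (\<lambda>x y z. g 0 (f2 0 x y z) (f3 0 x y z))"
          by (intro polyfun_subst[OF wpol_imp_polyfun[OF g(1)]] polyfun_f2 polyfun_f3 wpol.zero)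
        show "f2 0 x y z * g 0 (f2 0 x y z) (f3 0 x y z) = 0" for x y z
          using less.prems(2)[of x y z] Qg by simp
      qed
      moreover have "nat (d - 1 + 1) < nat (d + 1)" using False by simp
      ultimately have "g 0 s t = 0" using less.hyps[OF _ g(1)] by blast
      then show ?thesis using Qg by simp
    qed
  qed
  have "Q x y z = 0"
    if "wpol 1 1 1 d Q" "\<And>x y z. Q z (f2 c x y z) (f3 c x y z) = 0" for d Q x y z
    using that
  proof (induction "nat (d + 1)" arbitrary: d Q x y z rule: less_induct)
    case less
    show ?case
    proof (cases "d < 0")
      case True
      then show ?thesis by (rule wpol_neg[OF less.prems(1)])
    next
      case False
      have "Q 0 (f2 0 x y z) (f3 0 x y z) = 0" for x y z
        using less.prems(2)[of 0 x y] f2_z0[of c x y z] f3_z0[of c x y z] by simp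
      from plane[OF less.prems(1) this] have p0: "Q 0 s t = 0" for s t .
      obtain g where g: "wpol 1 1 1 (d - 1) g" "\<And>x y z. Q x y z = x * g x y z"
        using wpol_split_fst[OF less.prems(1)] p0 by auto
      have "g z (f2 c x y z) (f3 c x y z) = 0" for x y z
      proof (rule polyfun_mult_eq_0[where f = "\<lambda>x y z. z" and g = "\<lambda>x y z. g z (f2 c x y z) (f3 c x y z)",
            OF _ _ _ one_neq_zero])
        show "polyfun (\<lambda>x y z. z :: 'k)" by (rule wpol.thd) simp
        then show "polyfun (\<lambda>x y z. g z (f2 c x y z) (f3 c x y z))"
          by (intro polyfun_subst[OF wpol_imp_polyfun[OF g(1)]] polyfun_f2 polyfun_f3)
        show "z * g z (f2 c x y z) (f3 c x y z) = 0" for x y z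
          using less.prems(2)[of z x y] g(2) by simp
      qed
      moreover have "nat (d - 1 + 1) < nat (d + 1)" using False by simp
      ultimately have "g x y z = 0" using less.hyps[OF _ g(1)] by blast
      then show ?thesis using g(2) by simp
    qed
  qed
  with polyfun_imp_wpol[OF assms(1)] assms(2) show ?thesis by blast
qed

end

section \<open>Groups of affine maps with linear part \<open>SL\<^sub>2(F)\<close>\<close>

text \<open>\<open>A a b c d p r\<close> says that \<open>(x, y, z) \<mapsto> (a x + b y + p z, c x + d y + r z, z)\<close> is in the group.\<close>

locale affine_group =
  fixes F :: "'k::alg_closed_field set" and n :: nat
    and A :: "'k \<Rightarrow> 'k \<Rightarrow> 'k \<Rightarrow> 'k \<Rightarrow> 'k \<Rightarrow> 'k \<Rightarrow> bool" and t :: 'k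
  assumes base: "char2_subfield F n 1"
    and A_id: "A 1 0 0 1 0 0"
    and A_comp: "\<And>a b c d p r a' b' c' d' p' r'. A a b c d p r \<Longrightarrow> A a' b' c' d' p' r' \<Longrightarrow>
      A (a * a' + b * c') (a * b' + b * d') (c * a' + d * c') (c * b' + d * d')
        (a * p' + b * r' + p) (c * p' + d * r' + r)"
    and A_SL: "\<And>a b c d p r. A a b c d p r \<Longrightarrow>
      a \<in> F \<and> b \<in> F \<and> c \<in> F \<and> d \<in> F \<and> a * d - b * c = 1"
    and A_surj: "\<And>a b c d. a \<in> F \<Longrightarrow> b \<in> F \<Longrightarrow> c \<in> F \<Longrightarrow> d \<in> F \<Longrightarrow> a * d - b * c = 1 \<Longrightarrow>
      \<exists>p r. A a b c d p r"
    and finite_A: "finite {(p, r). A 1 0 0 1 p r}"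
    and t: "t \<in> F" "t \<noteq> 0" "t \<noteq> 1" and A_t: "A t 0 0 (inverse t) 0 0"
begin

section \<open>The translation subgroup and its orbit products\<close>

definition U :: "'k set" where "U = {u. A 1 0 0 1 u 0}"

text \<open>The orbit product of one coordinate under the translations, called \<xi> or \<eta> when
  applied to \<open>x\<close> or \<open>y\<close>.\<close>

definition PU :: "'k \<Rightarrow> 'k \<Rightarrow> 'k" where "PU x z = (\<Prod>u\<in>U. x + u * z)"

lemma U_0: "0 \<in> U" by (simp add: U_def A_id)

lemma finite_U: "finite U"
proof -
  have "(\<lambda>u. (u, 0)) ` U \<subseteq> {(p, r). A 1 0 0 1 p r}" by (auto simp: U_def)
  then have "finite ((\<lambda>u. (u, 0::'k)) ` U)" by (rule finite_subset[OF _ finite_A])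
  then show ?thesis by (rule finite_imageD) (auto simp: inj_on_def)
qed

lemma card_U: "card U > 0" using finite_U U_0 by (auto simp: card_gt_0_iff)

text \<open>The exponent \<open>1\<close> in \<open>base\<close> is only a placeholder, as
  \<open>U\<close> is not yet available there; the true exponent in the cocycle is
  \<open>card U\<close>.\<close>

sublocale char2_subfield F n "card U"
  using base card_U unfolding char2_subfield_def by simp

lemma char2_simps: "u + u = (0::'k)" "u + (u + v) = v" "u - v = u + v" "- u = u"
  using add_self[of u] minus2[of u v] uminus2[of u] by (simp_all add: add.assoc[symmetric])

lemma translation_add: "A 1 0 0 1 p r \<Longrightarrow> A 1 0 0 1 p' r' \<Longrightarrow> A 1 0 0 1 (p + p') (r + r')"
  using A_comp[of 1 0 0 1 p r 1 0 0 1 p' r'] by (simp add: add.commute)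

text \<open>Conjugation acts on translations through the linear part. In place of the inverse of the
  given element \<open>g\<close>, any \<open>h\<close> with the inverse linear part serves:
  composing with and without the translation in between gives two translations whose sum is the one
  wanted.\<close>

lemma translation_conj:
  assumes "A a b c d p r" "A 1 0 0 1 u v"
  shows "A 1 0 0 1 (a * u + b * v) (c * u + d * v)"
proof -
  have F: "a \<in> F" "b \<in> F" "c \<in> F" "d \<in> F" and det: "a * d + b * c = 1"
    using A_SL[OF assms(1)] by (auto simp: char2_simps)
  obtain p' r' where h: "A d b c a p' r'"
    using A_surj[of d b c a] F det by (auto simp: char2_simps ac_simps)
  have m: "a * d + b * c = 1" "a * b + b * a = 0" "c * d + d * c = 0" "c * b + d * a = 1"
    using det char2_simps(1)[of "a * b"] char2_simps(1)[of "c * d"] by (simp_all add: ac_simps)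
  have 1: "A 1 0 0 1 (a * p' + b * r' + p) (c * p' + d * r' + r)"
    using A_comp[OF assms(1) h] unfolding m .
  have "A a b c d (a * u + b * v + p) (c * u + d * v + r)"
    using A_comp[OF assms] by simp
  from A_comp[OF this h] have 2: "A 1 0 0 1 (a * p' + b * r' + (a * u + b * v + p)) (c * p' + d * r' + (c * u + d * v + r))"
    unfolding m .
  have cancel: "(x + y) + (x + (w + y)) = w" for x y w :: 'k
  proof -
    have "(x + y) + (x + (w + y)) = (x + x) + (y + y) + w" by (simp only: ac_simps)
    then show ?thesis by (simp add: char2_simps(1))
  qed
  show ?thesis using translation_add[OF 1 2] unfolding cancel .
qed

lemma translation_SL:
  assumes "a \<in> F" "b \<in> F" "c \<in> F" "d \<in> F" "a * d + b * c = 1" "A 1 0 0 1 u v"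
  shows "A 1 0 0 1 (a * u + b * v) (c * u + d * v)"
  using A_surj[of a b c d] translation_conj[OF _ assms(6)] assms(1-5) by (auto simp: char2_simps)

text \<open>A shear maps \<open>(u, v)\<close> to \<open>(u + v, v)\<close>; adding
  \<open>(u, v)\<close> leaves \<open>(v, 0)\<close>. The swap treats the other coordinate.\<close>

lemma translation_iff: "A 1 0 0 1 u v \<longleftrightarrow> u \<in> U \<and> v \<in> U"
proof -
  have snd: "v \<in> U" if "A 1 0 0 1 u v" for u v
  proof -
    have "A 1 0 0 1 (u + v) v" using translation_SL[of 1 1 0 1 u v] that F_0 F_1 by simp
    from translation_add[OF that this] show ?thesis by (simp add: U_def char2_simps)
  qed
  have swap: "A 1 0 0 1 v u" if "A 1 0 0 1 u v" for u v
    using translation_SL[of 0 1 1 0 u v] that F_0 F_1 by simp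
  have "A 1 0 0 1 u v" if "u \<in> U" "v \<in> U"
    using translation_add[of u 0 0 v] swap[of v 0] that by (simp add: U_def)
  then show ?thesis using snd swap by blast
qed

lemma U_add: "u \<in> U \<Longrightarrow> v \<in> U \<Longrightarrow> u + v \<in> U"
  using translation_add[of u 0 v 0] by (simp add: U_def)

text \<open>The shear with entry \<open>s\<close> maps the translation \<open>(0, u)\<close> to
  \<open>(s * u, u)\<close>.\<close>

lemma U_scale: assumes "s \<in> F" "u \<in> U" shows "s * u \<in> U"
proof -
  have "A 1 0 0 1 0 u" using translation_iff assms(2) U_0 by blast
  then have "A 1 0 0 1 (s * u) u" using translation_SL[of 1 s 0 1 0 u] assms(1) F_0 F_1 by simp
  then show ?thesis using translation_iff by blast
qed

lemma PU_translate: assumes "u \<in> U" shows "PU (x + u * z) z = PU x z"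
  unfolding PU_def
  by (rule prod.reindex_bij_witness[of _ "\<lambda>v. v + u" "\<lambda>v. v + u"])
    (use assms U_add in \<open>auto simp: algebra_simps char2_simps\<close>)

lemma PU_0: "PU 0 z = 0"
  unfolding PU_def using finite_U U_0 by (intro prod_zero) auto

lemma polyfun_PU: "polyfun (\<lambda>x y z. PU x z)"
  unfolding PU_def by (intro polyfun_prod wpol.add wpol_scale wpol.fst wpol.thd) auto

text \<open>For fixed \<open>z\<close> this is a monic polynomial in \<open>x\<close> of positive
  degree. Hence \<xi> and \<eta> may be treated as free variables.\<close>

lemma PU_surj: "\<exists>x. PU x z = \<xi>"
proof -
  define p where "p = (\<Prod>u\<in>U. [:u * z, 1:])"
  have deg: "degree p = card U"
    unfolding p_def by (subst degree_prod_eq_sum_degree) auto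
  then have "degree (p + [:- \<xi>:]) > 0" using card_U by (simp add: degree_add_eq_left)
  then obtain x where "poly (p + [:- \<xi>:]) x = 0" using alg_closed_imp_poly_has_root by blast
  then have "poly p x = \<xi>" by simp
  then show ?thesis by (intro exI[of _ x]) (simp add: p_def PU_def poly_prod add.commute)
qed

text \<open>As a function of \<open>x\<close>, \<open>PU (x + y) z - PU y z\<close> vanishes at all
  \<open>u * z\<close>, so it is a multiple of \<open>PU x z\<close>. By degree the multiplier is a
  constant, and evaluation at \<open>y = z = 0\<close> shows that it is 1.\<close>

lemma PU_add: "PU (x + y) z = PU x z + PU y z"
proof -
  let ?g = "\<lambda>x y z. PU (x + y) z - PU y z"
  have PU: "wpol 1 1 1 (int (card U)) (\<lambda>x y z. PU x z)"
    unfolding PU_def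
    using wpol_prod[of U 1 1 1 1 "\<lambda>u x y z. x + u * z"]
    by (simp add: wpol.add wpol_scale wpol.fst wpol.thd)
  have PU1: "wpol 1 1 1 (int (card U)) (\<lambda>x y z. PU (x + y) z)"
    by (rule wpol_subst[OF PU, of 1 1 1 "\<lambda>x y z. x + y" "\<lambda>x y z. y" "\<lambda>x y z. z"])
      (simp_all add: wpol.add wpol.fst wpol.snd wpol.thd)
  have PU2: "wpol 1 1 1 (int (card U)) (\<lambda>x y z. PU y z)"
    by (rule wpol_subst[OF PU, of 1 1 1 "\<lambda>x y z. y" "\<lambda>x y z. y" "\<lambda>x y z. z"])
      (simp_all add: wpol.snd wpol.thd)
  have van: "?g (u * z) y z = 0" if "u \<in> U" for u y z
    using PU_translate[OF that, of y z] by (simp add: add.commute)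
  have wz: "wpol 1 1 1 (int 1) (\<lambda>x y z. z :: 'k)" by (rule wpol.thd) simp
  obtain h where h: "wpol 1 1 1 (int (card U) - int (1 * card U)) h"
    "\<And>x y z. ?g x y z = (\<Prod>u\<in>U. x - u * z) * h x y z"
    using wpol_dvd_prod[of U 1 1 1 "\<lambda>y z. z" 1 1, OF finite_U wz one_neq_zero wpol_diff[OF PU1 PU2] van]
    by blast
  have "wpol (Suc 0) (Suc 0) (Suc 0) 0 h" using h(1) by simp
  then obtain k where k: "\<And>x y z. h x y z = k" using wpol_0_const by blast
  have g: "?g x y z = PU x z * k" for x y z
    using h(2)[of x y z] by (simp add: PU_def k char2_simps)
  obtain x0 where "PU x0 0 = 1" using PU_surj by blast
  then have "k = 1" using g[of x0 0 0] PU_0 by simp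
  then show ?thesis using g[of x y z] by (simp add: diff_eq_eq)
qed

lemma PU_scale: assumes "s \<in> F" shows "PU (s * x) z = s * PU x z"
proof (cases "s = 0")
  case True then show ?thesis by (simp add: PU_0)
next
  case False
  have "PU (s * x) z = (\<Prod>u\<in>U. s * (x + u * z))"
    unfolding PU_def
    by (rule prod.reindex_bij_witness[of _ "\<lambda>v. s * v" "\<lambda>v. inverse s * v"])
      (use False in \<open>simp_all add: U_scale assms F_inverse distrib_left flip: mult.assoc\<close>)
  also have "\<dots> = s ^ card U * PU x z" by (simp add: PU_def prod.distrib)
  also have "s ^ card U = s" by (rule power_card_eq_self[OF finite_U U_0 False U_scale[OF assms]])
  finally show ?thesis .
qed

lemma PU_homogeneous: "PU (p * z) z = PU p 1 * z ^ card U"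
proof -
  have "PU (p * z) z = (\<Prod>u\<in>U. (p + u * 1) * z)" unfolding PU_def by (simp add: algebra_simps)
  then show ?thesis by (simp add: PU_def prod.distrib)
qed

text \<open>Thus \<xi> and \<eta> are again transformed by affine maps with the same linear part,
  with \<open>z ^ card U\<close> in the role of \<open>z\<close>.\<close>

lemma PU_affine: "a \<in> F \<Longrightarrow> b \<in> F \<Longrightarrow>
    PU (a * x + b * y + p * z) z = a * PU x z + b * PU y z + PU p 1 * z ^ card U"
  by (simp add: PU_add PU_scale PU_homogeneous)

text \<open>The induced action on \<open>(PU x z, PU y z)\<close>: the translation part is now determined by the matrix.\<close>

definition H :: "'k \<Rightarrow> 'k \<Rightarrow> 'k \<Rightarrow> 'k \<Rightarrow> 'k \<Rightarrow> 'k \<Rightarrow> bool" where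
  "H a b c d P R \<longleftrightarrow> (\<exists>p r. A a b c d p r \<and> P = PU p 1 \<and> R = PU r 1)"

lemma H_comp:
  assumes "H a b c d P R" "H a' b' c' d' P' R'"
  shows "H (a * a' + b * c') (a * b' + b * d') (c * a' + d * c') (c * b' + d * d')
        (a * P' + b * R' + P) (c * P' + d * R' + R)"
proof -
  obtain p r p' r' where *: "A a b c d p r" "P = PU p 1" "R = PU r 1"
    "A a' b' c' d' p' r'" "P' = PU p' 1" "R' = PU r' 1" using assms unfolding H_def by blast
  have F: "a \<in> F" "b \<in> F" "c \<in> F" "d \<in> F" using A_SL[OF *(1)] by auto
  show ?thesis unfolding H_def
    by (intro exI conjI, rule A_comp[OF *(1,4)])
      (use PU_affine[OF F(1,2), of p' r' p 1] PU_affine[OF F(3,4), of p' r' r 1] * in simp_all)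
qed

text \<open>Two elements with the same linear part differ by a translation, which \<open>PU\<close>
  does not see. The translation is obtained by composing both with one \<open>h\<close> of inverse
  linear part, adding, and conjugating back.\<close>

lemma H_unique:
  assumes "H a b c d P R" "H a b c d P' R'"
  shows "P = P'" "R = R'"
proof -
  obtain p r p' r' where *: "A a b c d p r" "P = PU p 1" "R = PU r 1"
    "A a b c d p' r'" "P' = PU p' 1" "R' = PU r' 1" using assms unfolding H_def by blast
  have F: "a \<in> F" "b \<in> F" "c \<in> F" "d \<in> F" and det: "a * d + b * c = 1"
    using A_SL[OF *(1)] by (auto simp: char2_simps)
  obtain p0 r0 where h: "A d b c a p0 r0"
    using A_surj[of d b c a] F det by (auto simp: char2_simps ac_simps)
  have m: "d * a + b * c = 1" "d * b + b * d = 0" "c * a + a * c = 0" "c * b + a * d = 1"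
    using det char2_simps(1)[of "d * b"] char2_simps(1)[of "c * a"] by (simp_all add: ac_simps)
  have "A 1 0 0 1 (d * p + b * r + p0) (c * p + a * r + r0)"
    using A_comp[OF h *(1)] unfolding m .
  moreover have "A 1 0 0 1 (d * p' + b * r' + p0) (c * p' + a * r' + r0)"
    using A_comp[OF h *(4)] unfolding m .
  ultimately have diff: "A 1 0 0 1 ((d * p + b * r + p0) + (d * p' + b * r' + p0))
      ((c * p + a * r + r0) + (c * p' + a * r' + r0))" by (rule translation_add)
  have "A 1 0 0 1 (p + p') (r + r')"
  proof -
    have "a * ((d * p + b * r + p0) + (d * p' + b * r' + p0)) + b * ((c * p + a * r + r0) + (c * p' + a * r' + r0))
      = (a * d + b * c) * (p + p') + (a * b * (r + r') + a * b * (r + r')) + a * (p0 + p0) + b * (r0 + r0)"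
      by (simp add: algebra_simps)
    then have 1: "a * ((d * p + b * r + p0) + (d * p' + b * r' + p0)) + b * ((c * p + a * r + r0) + (c * p' + a * r' + r0)) = p + p'"
      by (simp only: det char2_simps(1)) simp
    have "c * ((d * p + b * r + p0) + (d * p' + b * r' + p0)) + d * ((c * p + a * r + r0) + (c * p' + a * r' + r0))
      = (a * d + b * c) * (r + r') + (c * d * (p + p') + c * d * (p + p')) + c * (p0 + p0) + d * (r0 + r0)"
      by (simp add: algebra_simps)
    then have 2: "c * ((d * p + b * r + p0) + (d * p' + b * r' + p0)) + d * ((c * p + a * r + r0) + (c * p' + a * r' + r0)) = r + r'"
      by (simp only: det char2_simps(1)) simp
    show ?thesis using translation_conj[OF *(1) diff] unfolding 1 2 .
  qed
  then have "p + p' \<in> U" "r + r' \<in> U" using translation_iff by blast+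
  then have "PU (p + (p + p') * 1) 1 = PU p 1" "PU (r + (r + r') * 1) 1 = PU r 1"
    using PU_translate by blast+
  then show "P = P'" "R = R'" by (simp_all add: char2_simps *)
qed

lemma H_surj:
  assumes "a \<in> F" "b \<in> F" "c \<in> F" "d \<in> F" "a * d + b * c = 1" shows "\<exists>P R. H a b c d P R"
  using A_surj[of a b c d] assms unfolding H_def by (auto simp: char2_simps)

lemma H_id: "H 1 0 0 1 0 0"
  unfolding H_def using A_id PU_0 by metis

lemma H_t: "H t 0 0 (inverse t) 0 0"
  unfolding H_def using A_t PU_0 by metis

section \<open>Normalising the cocycle on torus, Weyl element and unipotent elements\<close>

lemma t_fix: "t * P = P \<Longrightarrow> P = 0" "inverse t * P = P \<Longrightarrow> P = 0"
  using t by (auto simp: field_simps)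

text \<open>Commuting with the element for \<open>t\<close>, whose translation part is 0, makes the
  translation part \<open>(P, R)\<close> a fixed vector of diag(t, 1/t), hence 0.\<close>

lemma H_diag: assumes "a \<in> F" "a \<noteq> 0" shows "H a 0 0 (inverse a) 0 0"
proof -
  obtain P R where h: "H a 0 0 (inverse a) P R"
    using H_surj[of a 0 0 "inverse a"] assms F_0 F_inverse by auto
  have 1: "H (t * a) 0 0 (inverse t * inverse a) (t * P) (inverse t * R)"
    using H_comp[OF H_t h] by simp
  have 2: "H (t * a) 0 0 (inverse t * inverse a) P R"
    using H_comp[OF h H_t] by (simp add: mult.commute)
  have "P = 0" "R = 0" using H_unique[OF 1 2] t_fix by blast+
  with h show ?thesis by simp
qed

text \<open>With D = diag(t, 1/t) and the Weyl element w one has D w D = w, so the translation part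
  of w is again fixed by D.\<close>

lemma H_swap: "H 0 1 1 0 0 0"
proof -
  obtain P R where h: "H 0 1 1 0 P R"
    using H_surj[of 0 1 1 0] F_0 F_1 by auto
  have "H 0 (inverse t) t 0 P R" using H_comp[OF h H_t] by simp
  from H_comp[OF H_t this] have 1: "H 0 1 1 0 (t * P) (inverse t * R)" using t by simp
  have "P = 0" "R = 0" using H_unique[OF 1 h] t_fix by blast+
  with h show ?thesis by simp
qed

text \<open>The matrix with upper entry 1 is an involution, which forces the second component
  \<open>c'\<close> to be 0. Conjugation by diag(s, 1/s) turns the entry 1 into s^2 and the
  translation part \<open>c\<close> into \<open>s * c\<close>.\<close>

lemma H_unipotent: "\<exists>c. \<forall>s\<in>F. H 1 (s\<^sup>2) 0 1 (c * s) 0"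
proof -
  obtain c c' where h: "H 1 1 0 1 c c'" using H_surj[of 1 1 0 1] F_0 F_1 by auto
  have "H 1 0 0 1 c' 0" using H_comp[OF h h] by (simp add: char2_simps two_eq_0)
  from H_unique(1)[OF this H_id] have h: "H 1 1 0 1 c 0" using h by simp
  have "H 1 (s\<^sup>2) 0 1 (c * s) 0" if s: "s \<in> F" for s
  proof (cases "s = 0")
    case True
    then show ?thesis using H_id by simp
  next
    case False
    obtain P R where g: "H 1 (s\<^sup>2) 0 1 P R" using H_surj[of 1 "s\<^sup>2" 0 1] F_0 F_1 F_mult s
      by (auto simp: power2_eq_square)
    have 1: "H s s 0 (inverse s) (s * c) 0" using H_comp[OF H_diag[OF s False] h] by simp
    have 2: "H s s 0 (inverse s) P R"
      using H_comp[OF g H_diag[OF s False]] False by (simp add: power2_eq_square mult.assoc)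
    show ?thesis using H_unique[OF 1 2] g by (simp add: mult.commute)
  qed
  then show ?thesis by blast
qed

text \<open>The one constant left of the normalised cocycle; it becomes the coefficient
  \<open>c\<close> of the quadratic form.\<close>

definition \<kappa> :: 'k where "\<kappa> = (SOME c. \<forall>s\<in>F. H 1 (s\<^sup>2) 0 1 (c * s) 0)"

lemma H_\<kappa>: "s \<in> F \<Longrightarrow> H 1 (s\<^sup>2) 0 1 (\<kappa> * s) 0"
  using someI_ex[OF H_unipotent] unfolding \<kappa>_def by blast

lemma H_invariant:
  assumes P: "inv_fun \<kappa> f" and h: "H a b c d P R"
  shows "f (a * \<xi> + b * \<eta> + P * z ^ card U) (c * \<xi> + d * \<eta> + R * z ^ card U) z = f \<xi> \<eta> z"
proof -
  \<comment> \<open>Group elements together with the invariance of \<open>f\<close> under them; this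
    is closed under composition and contains the generators.\<close>
  define I where "I a b c d P R \<longleftrightarrow> H a b c d P R \<and>
    (\<forall>\<xi> \<eta> z. f (a * \<xi> + b * \<eta> + P * z ^ card U) (c * \<xi> + d * \<eta> + R * z ^ card U) z = f \<xi> \<eta> z)"
    for a b c d P R
  have I_comp: "I (a * a' + b * c') (a * b' + b * d') (c * a' + d * c') (c * b' + d * d')
        (a * P' + b * R' + P) (c * P' + d * R' + R)"
    if i: "I a b c d P R" "I a' b' c' d' P' R'" for a b c d P R a' b' c' d' P' R'
    unfolding I_def
  proof (intro conjI allI)
    fix \<xi> \<eta> z
    let ?u = "a' * \<xi> + b' * \<eta> + P' * z ^ card U" and ?v = "c' * \<xi> + d' * \<eta> + R' * z ^ card U"
    have "f (a * ?u + b * ?v + P * z ^ card U) (c * ?u + d * ?v + R * z ^ card U) z = f \<xi> \<eta> z"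
      using i unfolding I_def by simp
    then show "f ((a * a' + b * c') * \<xi> + (a * b' + b * d') * \<eta> + (a * P' + b * R' + P) * z ^ card U)
       ((c * a' + d * c') * \<xi> + (c * b' + d * d') * \<eta> + (c * P' + d * R' + R) * z ^ card U) z = f \<xi> \<eta> z"
      by (simp add: algebra_simps)
  qed (use i H_comp in \<open>auto simp: I_def\<close>)
  have I_u: "I 1 (s\<^sup>2) 0 1 (\<kappa> * s) 0" if "s \<in> F" for s
    using H_\<kappa>[OF that] inv_funD(1)[OF P that] by (simp add: I_def ac_simps)
  have I_d: "I a 0 0 (inverse a) 0 0" if "a \<in> F" "a \<noteq> 0" for a
    using H_diag[OF that] inv_funD(3)[OF P, of a] that by (simp add: I_def field_simps)
  have I_w: "I 0 1 1 0 0 0"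
    using H_swap inv_funD(2)[OF P] by (simp add: I_def)
  have F: "a \<in> F" "b \<in> F" "c \<in> F" "d \<in> F" and det: "a * d + b * c = 1"
    using h A_SL unfolding H_def by (auto simp: char2_simps)
  \<comment> \<open>Bruhat decomposition, with u(v) the upper unipotent matrix with entry v and w
    the swap: u(a b) diag(a, 1/a) for \<open>c = 0\<close>, and u(a/c) w diag(c, 1/c) u(d/c)
    otherwise. Entries of u are written as squares to match \<open>I_u\<close>.\<close>
  have "\<exists>P R. I a b c d P R"
  proof (cases "c = 0")
    case True
    then have a: "a \<noteq> 0" "d = inverse a" using det by (auto simp: inverse_unique)
    obtain s where s: "s \<in> F" "a * b = s\<^sup>2" using F_square_root F_mult F by metis
    have m: "a * b * inverse a = b" using a(1) by (simp add: field_simps)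
    have "I a (a * b * inverse a) 0 (inverse a) (\<kappa> * s) 0"
      using I_comp[OF I_u[OF s(1)] I_d[OF F(1) a(1)]] by (simp flip: s(2))
    then have "I a b 0 (inverse a) (\<kappa> * s) 0" unfolding m .
    then show ?thesis using a(2) True by blast
  next
    case False
    obtain s where s: "s \<in> F" "a * inverse c = s\<^sup>2" using F_square_root F_mult F_inverse F by metis
    obtain s' where s': "s' \<in> F" "inverse c * d = s'\<^sup>2" using F_square_root F_mult F_inverse F by metis
    have b: "inverse c + a * inverse c * d = b"
    proof -
      have "inverse c + a * inverse c * d = inverse c * (1 + a * d)" by (simp add: algebra_simps)
      also have "1 + a * d = b * c" using det char2_simps by (metis add.commute)
      finally show ?thesis using False by simp
    qed
    have 1: "I 0 (inverse c) c 0 0 0" using I_comp[OF I_w I_d[OF F(3) False]] by simp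
    have m: "c * (inverse c * d) = d" "a * inverse c * c = a" using False by (simp_all add: field_simps)
    have "\<exists>P R. I 0 (inverse c) c (c * (inverse c * d)) P R"
      using I_comp[OF 1 I_u[OF s'(1)]] by (auto simp flip: s'(2))
    then obtain P R where "I 0 (inverse c) c d P R" unfolding m by blast
    from I_comp[OF I_u[OF s(1)] this]
    have "\<exists>P R. I (a * inverse c * c) (inverse c + a * inverse c * d) c d P R"
      by (auto simp flip: s(2))
    then show ?thesis unfolding m b .
  qed
  then obtain P' R' where i: "I a b c d P' R'" by blast
  \<comment> \<open>The decomposition only reproduces the matrix; the translation part agrees by
    uniqueness.\<close>
  then have "P = P'" "R = R'" using H_unique[OF h] unfolding I_def by blast+
  with i show ?thesis unfolding I_def by blast
qed

section \<open>Invariants of the whole affine group\<close>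

lemma A_invariant:
  assumes "inv_fun \<kappa> f" "A a b c d p r"
  shows "f (PU (a * x + b * y + p * z) z) (PU (c * x + d * y + r * z) z) z = f (PU x z) (PU y z) z"
proof -
  have F: "a \<in> F" "b \<in> F" "c \<in> F" "d \<in> F" using A_SL[OF assms(2)] by auto
  have "H a b c d (PU p 1) (PU r 1)" using assms(2) unfolding H_def by blast
  from H_invariant[OF assms(1) this] show ?thesis by (simp add: PU_affine F)
qed

lemma A_invariant_imp_generated:
  assumes f: "polyfun f"
    and inv: "\<And>a b c d p r x y z. A a b c d p r \<Longrightarrow> f (a * x + b * y + p * z) (c * x + d * y + r * z) z = f x y z"
  shows "\<exists>Q. polyfun Q \<and>
    (\<forall>x y z. f x y z = Q z (f2 \<kappa> (PU x z) (PU y z) z) (f3 \<kappa> (PU x z) (PU y z) z))"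
proof -
  have z: "polyfun (\<lambda>x y z. z :: 'k)" by (rule wpol.thd) simp
  have "f (x + u * z) y z = f x y z" if "u \<in> U" for u x y z
    using inv[of 1 0 0 1 u 0 x y z] that by (simp add: U_def)
  then have "\<exists>G. polyfun G \<and> (\<forall>x y z. f x y z = G (\<Prod>u\<in>U. x + u * z) y z)"
    by (intro translation_invariant[of U "\<lambda>y z. z" 1 1, OF finite_U U_0 U_add _ z _ f])
      (simp_all add: char2_simps)
  then obtain G where G: "polyfun G" "\<And>x y z. f x y z = G (PU x z) y z"
    unfolding PU_def by blast
  let ?G = "\<lambda>x y z. G y x z"
  \<comment> \<open>Here \<open>y\<close> is an arbitrary value of the first orbit product, so it
    equals \<open>PU w z\<close> for some \<open>w\<close>, and the invariance of \<open>f\<close>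
    applies at \<open>(w, x, z)\<close>.\<close>
  have "?G (x + u * z) y z = ?G x y z" if u: "u \<in> U" for u x y z
  proof -
    obtain w where w: "PU w z = y" using PU_surj by blast
    have "A 1 0 0 1 0 u" using translation_iff u U_0 by blast
    then show ?thesis using inv[of 1 0 0 1 0 u w x z] w by (simp add: G(2))
  qed
  moreover have "polyfun ?G"
    by (intro polyfun_subst[OF G(1)] wpol.fst wpol.snd z) auto
  ultimately have "\<exists>G'. polyfun G' \<and> (\<forall>x y z. ?G x y z = G' (\<Prod>u\<in>U. x + u * z) y z)"
    by (intro translation_invariant[of U "\<lambda>y z. z" 1 1, OF finite_U U_0 U_add _ z])
      (simp_all add: char2_simps)
  then obtain G' where G': "polyfun G'" "\<And>x y z. G y x z = G' (PU x z) y z"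
    unfolding PU_def by blast
  define P where "P \<xi> \<eta> z = G' \<eta> \<xi> z" for \<xi> \<eta> z
  have fP: "f x y z = P (PU x z) (PU y z) z" for x y z
    by (simp add: G(2) G'(2) P_def)
  have pP: "polyfun P"
    unfolding P_def by (intro polyfun_subst[OF G'(1)] wpol.fst wpol.snd z) auto
  have H: "P (a * \<xi> + b * \<eta> + P' * z ^ card U) (c * \<xi> + d * \<eta> + R * z ^ card U) z = P \<xi> \<eta> z"
    if h: "H a b c d P' R" for a b c d P' R \<xi> \<eta> z
  proof -
    obtain p r where pr: "A a b c d p r" "P' = PU p 1" "R = PU r 1" using h unfolding H_def by blast
    have F: "a \<in> F" "b \<in> F" "c \<in> F" "d \<in> F" using A_SL[OF pr(1)] by auto
    obtain x y where "PU x z = \<xi>" "PU y z = \<eta>" using PU_surj by metis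
    then show ?thesis using inv[OF pr(1), of x y z] by (simp add: fP PU_affine F pr)
  qed
  have "inv_fun \<kappa> P"
    unfolding inv_fun_def
  proof (intro conjI ballI allI)
    show "P (x + s\<^sup>2 * y + s * (\<kappa> * z ^ card U)) y z = P x y z" if "s \<in> F" for s x y z
      using H[OF H_\<kappa>[OF that], of x y z] by (simp add: ac_simps)
    show "P y x z = P x y z" for x y z
      using H[OF H_swap, of x y z] by simp
    show "P (a * x) (y / a) z = P x y z" if "a \<in> F - {0}" for a x y z
      using H[OF H_diag[of a], of x y z] that by (simp add: field_simps)
  qed
  from inv_fun_imp_generated[OF pP this] show ?thesis unfolding fP by blast
qed

lemma f2_f3_PU_independent:
  assumes "polyfun Q" "\<And>x y z. Q z (f2 \<kappa> (PU x z) (PU y z) z) (f3 \<kappa> (PU x z) (PU y z) z) = 0"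
  shows "Q x y z = 0"
proof (rule f2_f3_independent[OF assms(1)])
  fix \<xi> \<eta> z
  obtain x y where "PU x z = \<xi>" "PU y z = \<eta>" using PU_surj by metis
  then show "Q z (f2 \<kappa> \<xi> \<eta> z) (f3 \<kappa> \<xi> \<eta> z) = 0" using assms(2)[of z x y] by simp
qed

end

section \<open>Transfer to the vector space\<close>

lemma sum_power_eq_0:
  fixes g :: "'b \<Rightarrow> 'k::alg_closed_field"
  assumes "finite S" "\<And>t. (\<Sum>m\<in>S. g m * t ^ h m) = 0"
  shows "(\<Sum>m | m \<in> S \<and> h m = j. g m) = 0"
proof -
  have "(\<Sum>m\<in>S. monom (g m) (h m)) = 0"
    by (rule poly_eqI_alg_closed) (simp add: poly_sum poly_monom assms(2))
  then have "coeff (\<Sum>m\<in>S. monom (g m) (h m)) j = 0" by simp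
  then have "(\<Sum>m\<in>S. if h m = j then g m else 0) = 0" by (simp add: coeff_sum)
  then show ?thesis by (simp add: sum.inter_filter[OF assms(1), symmetric])
qed

text \<open>Passes from formal polynomials to polynomial functions: a formal polynomial in three
  variables that vanishes as a function is zero, because the field is infinite.\<close>

lemma algebraically_independentI:
  fixes f :: "nat \<Rightarrow> 'v \<Rightarrow> 'k::alg_closed_field"
  assumes "\<And>Q x y z. polyfun Q \<Longrightarrow> (\<And>v. Q (f 0 v) (f 1 v) (f 2 v) = 0) \<Longrightarrow> Q x y z = 0"
  shows "algebraically_independent 3 f"
  unfolding algebraically_independent_def
proof (intro allI impI)
  fix p :: "(nat \<Rightarrow>\<^sub>0 nat) \<Rightarrow>\<^sub>0 'k"
  assume keys: "\<forall>m\<in>Poly_Mapping.keys p. Poly_Mapping.keys m \<subseteq> {..<3}" and ev: "eval_poly p f = 0"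
  let ?l = "Poly_Mapping.lookup"
  define S where "S = Poly_Mapping.keys p"
  have fin: "finite S" by (simp add: S_def)
  define Q where "Q x y z = (\<Sum>m\<in>S. ?l p m * (x ^ ?l m 0 * y ^ ?l m 1 * z ^ ?l m 2))" for x y z
  have "(\<Prod>i\<in>Poly_Mapping.keys m. f i v ^ ?l m i) = f 0 v ^ ?l m 0 * f 1 v ^ ?l m 1 * f 2 v ^ ?l m 2"
    if "m \<in> S" for m v
  proof -
    have "(\<Prod>i\<in>Poly_Mapping.keys m. f i v ^ ?l m i) = (\<Prod>i<3. f i v ^ ?l m i)"
      by (rule prod.mono_neutral_left) (use that keys in \<open>auto simp: S_def in_keys_iff\<close>)
    then show ?thesis by (simp add: eval_nat_numeral)
  qed
  then have "Q (f 0 v) (f 1 v) (f 2 v) = eval_poly p f v" for v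
    by (simp add: Q_def eval_poly_def S_def)
  then have Q0: "Q (f 0 v) (f 1 v) (f 2 v) = 0" for v by (simp add: ev)
  have x: "polyfun (\<lambda>x y z. x :: 'k)" and y: "polyfun (\<lambda>x y z. y :: 'k)" and z: "polyfun (\<lambda>x y z. z :: 'k)"
    by (rule wpol.intros; simp)+
  have pow: "polyfun (\<lambda>x y z. g x y z ^ j)" if "polyfun g" for g :: "'k \<Rightarrow> 'k \<Rightarrow> 'k \<Rightarrow> 'k" and j
    using wpol_power[OF that, of j] by simp
  have "polyfun Q" unfolding Q_def
    by (intro wpol_sum wpol_scale polyfun_mult pow x y z)
  then have Q: "Q x y z = 0" for x y z using assms Q0 by blast
  have "?l p m = 0" for m
  proof (rule ccontr)
    assume "?l p m \<noteq> 0"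
    then have m: "m \<in> S" by (simp add: S_def in_keys_iff)
    \<comment> \<open>The coefficient of \<open>m\<close> is isolated one variable at a time: each
      step keeps the monomials with the same exponent as \<open>m\<close> in the next
      variable.\<close>
    define S1 where "S1 = {m' \<in> S. ?l m' 0 = ?l m 0}"
    define S2 where "S2 = {m' \<in> S1. ?l m' 1 = ?l m 1}"
    have 1: "(\<Sum>m'\<in>S1. ?l p m' * (y ^ ?l m' 1 * z ^ ?l m' 2)) = 0" for y z
      unfolding S1_def
      by (rule sum_power_eq_0[OF fin]) (use Q[of _ y z] in \<open>simp add: Q_def ac_simps\<close>)
    have 2: "(\<Sum>m'\<in>S2. ?l p m' * z ^ ?l m' 2) = 0" for z
      unfolding S2_def
      by (rule sum_power_eq_0) (use fin 1[of _ z] in \<open>simp_all add: S1_def ac_simps\<close>)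
    have 3: "(\<Sum>m' | m' \<in> S2 \<and> ?l m' 2 = ?l m 2. ?l p m') = 0"
      by (rule sum_power_eq_0) (use fin 2 in \<open>simp_all add: S1_def S2_def\<close>)
    have "m' = m" if "m' \<in> S2" "?l m' 2 = ?l m 2" for m'
    proof (rule poly_mapping_eqI)
      fix i
      have m': "m' \<in> S" "?l m' 0 = ?l m 0" "?l m' 1 = ?l m 1" using that by (auto simp: S1_def S2_def)
      show "?l m' i = ?l m i"
      proof (cases "i < 3")
        case True
        then have "i = 0 \<or> i = 1 \<or> i = 2" by auto
        then show ?thesis using m' that by auto
      next
        case False
        then have "i \<notin> Poly_Mapping.keys m'" "i \<notin> Poly_Mapping.keys m" using keys m m'(1) unfolding S_def by blast+
        then show ?thesis by (simp add: in_keys_iff)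
      qed
    qed
    then have "{m'. m' \<in> S2 \<and> ?l m' 2 = ?l m 2} = {m}" using m by (auto simp: S1_def S2_def)
    with 3 \<open>?l p m \<noteq> 0\<close> show False by simp
  qed
  then show "p = 0" by (intro poly_mapping_eqI) simp
qed

lemma generated_algebra_polyfun:
  assumes "polyfun Q" "f \<in> generated_algebra A" "g \<in> generated_algebra A" "h \<in> generated_algebra A"
  shows "(\<lambda>v. Q (f v) (g v) (h v)) \<in> generated_algebra A"
proof -
  have "(\<lambda>v. Q (f v) (g v) (h v)) \<in> generated_algebra A" if "wpol 0 0 0 d Q" for d
    using that
  proof induction
    case (add d Q1 Q2)
    from generated_algebra.add[OF add.IH] show ?case by (simp add: plus_fun_def)
  next
    case (mult d Q1 d' Q2)
    from generated_algebra.mult[OF mult.IH] show ?case by (simp add: times_fun_def)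
  qed (use assms(2-4) in \<open>auto intro: generated_algebra.const\<close>)
  with assms(1) show ?thesis by blast
qed

lemma generated_algebra_subset:
  assumes "A \<subseteq> generated_algebra B" shows "generated_algebra A \<subseteq> generated_algebra B"
proof
  fix f assume "f \<in> generated_algebra A"
  then show "f \<in> generated_algebra B"
    by induction (use assms in \<open>blast intro: generated_algebra.intros\<close>)+
qed

text \<open>A copy of \<open>vector_space\<close>, whose interpretation for real vector spaces
  would shadow the names introduced below.\<close>

locale k_space = vector_space scale for scale :: "'a::alg_closed_field \<Rightarrow> 'b::ab_group_add \<Rightarrow> 'b"
begin

section \<open>Homogeneous functions\<close>

lemma module_functions: "Modules.module (\<lambda>(c::'a) f (v::'v). c * f v)"
  by unfold_locales (auto simp: plus_fun_def algebra_simps)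

text \<open>Multiplication by \<open>g\<close> raises the degree by \<open>d\<close>; with \<open>1 \<in> S\<^sup>0\<close> this says that
  \<open>g\<close> is homogeneous of degree \<open>d\<close>, but it is closed under products by definition.\<close>

definition degree_shift :: "nat \<Rightarrow> ('b \<Rightarrow> 'a) \<Rightarrow> bool" where
  "degree_shift d g \<longleftrightarrow> (\<forall>a. \<forall>f\<in>sym_power scale a. (\<lambda>v. g v * f v) \<in> sym_power scale (a + d))"

lemma degree_shiftD:
  "degree_shift d g \<Longrightarrow> f \<in> sym_power scale a \<Longrightarrow> (\<lambda>v. g v * f v) \<in> sym_power scale (a + d)"
  by (simp add: degree_shift_def)

lemma degree_shift_const: "degree_shift 0 (\<lambda>v. c)"
  unfolding degree_shift_def sym_power_def
  using module.span_scale[OF module_functions] by auto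

lemma degree_shift_add: "degree_shift d f \<Longrightarrow> degree_shift d g \<Longrightarrow> degree_shift d (\<lambda>v. f v + g v)"
  unfolding degree_shift_def sym_power_def
  using module.span_add[OF module_functions] by (fastforce simp: plus_fun_def distrib_right)

lemma degree_shift_mult:
  assumes "degree_shift d f" "degree_shift d' g" shows "degree_shift (d + d') (\<lambda>v. f v * g v)"
  unfolding degree_shift_def
proof (intro allI ballI)
  fix a h assume "h \<in> sym_power scale a"
  from degree_shiftD[OF assms(1) degree_shiftD[OF assms(2) this]]
  have "(\<lambda>v. f v * (g v * h v)) \<in> sym_power scale (a + d' + d)" .
  then show "(\<lambda>v. f v * g v * h v) \<in> sym_power scale (a + (d + d'))" by (simp add: ac_simps)
qed

lemma degree_shift_prod:
  assumes "finite I" "\<And>i. i \<in> I \<Longrightarrow> degree_shift d (g i)"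
  shows "degree_shift (d * card I) (\<lambda>v. \<Prod>i\<in>I. g i v)"
  using assms
proof (induction I)
  case empty
  show ?case using degree_shift_const[of 1] by simp
next
  case (insert i I)
  then have "degree_shift (d + d * card I) (\<lambda>v. g i v * (\<Prod>i\<in>I. g i v))"
    by (intro degree_shift_mult) auto
  with insert.hyps show ?case by simp
qed

lemma degree_shift_linear:
  assumes "l \<in> dual_space scale" shows "degree_shift 1 l"
  unfolding degree_shift_def
proof (intro allI ballI)
  fix a f assume "f \<in> sym_power scale a"
  then show "(\<lambda>v. l v * f v) \<in> sym_power scale (a + 1)"
    unfolding sym_power_def
  proof (induction rule: module.span_induct_alt[OF module_functions, consumes 1, case_names zero step])
    case zero
    have "(\<lambda>v. l v * (0 :: 'b \<Rightarrow> 'a) v) = 0" by (auto simp: zero_fun_def)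
    then show ?case using module.span_zero[OF module_functions] by metis
  next
    case (step c f g)
    then obtain k where k: "f = (\<lambda>v. \<Prod>i<a. k i v)" "\<forall>i<a. k i \<in> dual_space scale" by blast
    \<comment> \<open>The new factor is placed at the first free index \<open>a\<close>.\<close>
    have "(\<lambda>v. l v * f v) = (\<lambda>v. \<Prod>i<a + 1. (k(a := l)) i v)"
      by (rule ext) (simp add: k(1) mult.commute)
    then have "(\<lambda>v. l v * f v) \<in> {\<lambda>v. \<Prod>i<a + 1. l i v |l. \<forall>i<a + 1. l i \<in> dual_space scale}"
      using k(2) assms by (intro CollectI exI[of _ "k(a := l)"]) (auto simp: less_Suc_eq)
    from module.span_add[OF module_functions module.span_scale[OF module_functions module.span_base[OF module_functions this]] step(2)]
    show ?case by (simp add: plus_fun_def algebra_simps)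
  qed
qed

lemma degree_shift_imp_homogeneous:
  assumes "degree_shift d g" shows "homogeneous scale g"
proof -
  have "(\<lambda>v. 1) \<in> sym_power scale 0"
    unfolding sym_power_def by (rule module.span_base[OF module_functions]) auto
  from degree_shiftD[OF assms this] show ?thesis unfolding homogeneous_def by auto
qed

section \<open>Bases and dual coordinates\<close>

lemma range_2: "range (b :: 2 \<Rightarrow> 'b) = {b 1, b 2}"
proof -
  have "(UNIV :: 2 set) = {1, 2}" using exhaust_2 by auto
  then show ?thesis by (metis image_empty image_insert)
qed

lemma representation_2:
  fixes b :: "2 \<Rightarrow> 'b"
  assumes "inj b" "independent (range b)"
  shows "representation (range b) (scale s (b 1) + scale t (b 2)) (b 1) = s"
    and "representation (range b) (scale s (b 1) + scale t (b 2)) (b 2) = t"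
proof -
  have ne: "b 1 \<noteq> b 2" using assms(1) by (auto dest: injD)
  have sp: "b i \<in> span (range b)" for i by (simp add: span_base)
  have "representation (range b) (scale s (b 1) + scale t (b 2)) w =
      s * representation (range b) (b 1) w + t * representation (range b) (b 2) w" for w
    by (simp add: representation_add representation_scale assms(2) sp span_scale)
  then show "representation (range b) (scale s (b 1) + scale t (b 2)) (b 1) = s"
    "representation (range b) (scale s (b 1) + scale t (b 2)) (b 2) = t"
    using ne by (simp_all add: representation_basis assms(2))
qed

lemma coordinates:
  fixes b :: "2 \<Rightarrow> 'b"
  assumes b: "inj b" "independent (range b)" and e: "e \<notin> span (range b)" and dim: "dim UNIV = 3"
  obtains x y z where "x \<in> dual_space scale" "y \<in> dual_space scale" "z \<in> dual_space scale"
    and "\<And>v. v = scale (x v) (b 1) + scale (y v) (b 2) + scale (z v) e"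
    and "x (b 1) = 1" "x (b 2) = 0" "x e = 0" "y (b 1) = 0" "y (b 2) = 1" "y e = 0"
    and "z (b 1) = 0" "z (b 2) = 0" "z e = 1"
proof -
  let ?B = "{e, b 1, b 2}"
  have ne: "b 1 \<noteq> b 2" using b(1) by (auto dest: injD)
  have e': "e \<noteq> b 1" "e \<noteq> b 2" using e span_base[of _ "range b"] by auto
  have ind: "independent ?B" using independent_insertI[OF e b(2)] by (simp add: range_2)
  \<comment> \<open>A basis with \<open>dim UNIV = 3\<close> elements is finite, so \<open>V\<close>
    is finite-dimensional and the three independent vectors of \<open>?B\<close> span it.\<close>
  obtain C where C: "independent C" "UNIV \<subseteq> span C" "card C = dim UNIV" using basis_exists by blast
  interpret C: finite_dimensional_vector_space scale C
    by unfold_locales (use C dim in \<open>auto intro: card_ge_0_finite\<close>)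
  have span: "v \<in> span ?B" for v
    using C.card_ge_dim_independent[OF subset_UNIV ind] ne e' dim by auto
  let ?r = "\<lambda>i v. representation ?B v i"
  have lin: "?r i \<in> dual_space scale" for i
    unfolding dual_space_def
    by (auto intro!: Vector_Spaces.linear.intro module_hom.intro module_hom_axioms.intro vector_space_axioms
        module_axioms simp: representation_add representation_scale ind span)
      (unfold_locales, auto simp: algebra_simps)
  have rep: "v = scale (?r (b 1) v) (b 1) + scale (?r (b 2) v) (b 2) + scale (?r e v) e" for v
    using sum_representation_eq[OF ind span, of ?B v] ne e' by (simp add: ac_simps)
  show ?thesis
    by (rule that[OF lin[of "b 1"] lin[of "b 2"] lin[of e] rep])
      (use ne e' in \<open>auto simp: representation_basis ind\<close>)
qed

end

lemma char2_subfieldI: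
  fixes F :: "'k::alg_closed_field set"
  assumes "CHAR('k) = 2" "n > 1" "subfield F (ring_of_type_algebra :: 'k ring)" "card F = 2 ^ n"
  shows "char2_subfield F n 1"
proof -
  let ?R = "ring_of_type_algebra :: 'k ring"
  note sub = subringE[OF subfieldE(1)[OF assms(3)], unfolded ring_of_type_algebra_def, simplified]
  have inv: "inverse a \<in> F" if "a \<in> F" for a
  proof (cases "a = 0")
    case True
    then show ?thesis using that by simp
  next
    case False
    have "inv\<^bsub>?R\<^esub> a \<in> F" "a * inv\<^bsub>?R\<^esub> a = 1"
      using ring.subfield_m_inv[OF ring_from_type_algebra assms(3), of a] that False
      by (auto simp: ring_of_type_algebra_def)
    then show ?thesis using inverse_unique by metis
  qed
  show ?thesis
    by unfold_locales (use assms(1,2,4) sub inv in simp_all)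
qed

section \<open>The group action in coordinates and its invariants\<close>

lemma act_eq_iff:
  assumes "bij g" shows "act g f = f \<longleftrightarrow> (\<forall>v. f (g v) = f v)"
proof
  assume *: "act g f = f"
  show "\<forall>v. f (g v) = f v"
  proof
    fix v
    have "f (g v) = act g f (g v)" by (simp add: *)
    also have "\<dots> = f v" using bij_is_inj[OF assms] by (simp add: act_def inv_f_f)
    finally show "f (g v) = f v" .
  qed
next
  assume *: "\<forall>v. f (g v) = f v"
  show "act g f = f"
  proof
    fix v
    have "act g f v = f (g (inv_into UNIV g v))" by (simp add: act_def *)
    then show "act g f v = f v" using bij_is_surj[OF assms] by (simp add: surj_f_inv_f)
  qed
qed

definition affine_action ::
  "('v \<Rightarrow> 'k::field) \<Rightarrow> ('v \<Rightarrow> 'k) \<Rightarrow> ('v \<Rightarrow> 'k) \<Rightarrow> ('v \<Rightarrow> 'v) \<Rightarrow> 'k \<Rightarrow> 'k \<Rightarrow> 'k \<Rightarrow> 'k \<Rightarrow> 'k \<Rightarrow> 'k \<Rightarrow> bool"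
where
  "affine_action x y z g a b c d p r \<longleftrightarrow>
    (\<forall>v. x (g v) = a * x v + b * y v + p * z v \<and> y (g v) = c * x v + d * y v + r * z v \<and> z (g v) = z v)"

lemma affine_action_comp:
  assumes "affine_action x y z g a b c d p r" "affine_action x y z h a' b' c' d' p' r'"
  shows "affine_action x y z (g \<circ> h) (a * a' + b * c') (a * b' + b * d') (c * a' + d * c') (c * b' + d * d')
        (a * p' + b * r' + p) (c * p' + d * r' + r)"
  using assms by (simp add: affine_action_def algebra_simps)

lemma (in k_space) polynomial_ring_invariants:
  fixes x y z :: "'b \<Rightarrow> 'a"
  assumes dim: "dim UNIV = 3"
    and dual: "x \<in> dual_space scale" "y \<in> dual_space scale" "z \<in> dual_space scale"
    and dual_gen: "\<And>l. l \<in> dual_space scale \<Longrightarrow> \<exists>\<alpha> \<beta> \<gamma>. \<forall>v. l v = \<alpha> * x v + \<beta> * y v + \<gamma> * z v"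
    and surj: "\<And>\<alpha> \<beta> \<gamma>. \<exists>v. x v = \<alpha> \<and> y v = \<beta> \<and> z v = \<gamma>"
    and bij: "\<And>g. g \<in> G \<Longrightarrow> bij g"
    and action: "\<And>g. g \<in> G \<Longrightarrow> \<exists>a b c d p r. affine_action x y z g a b c d p r"
    and group: "affine_group F n (\<lambda>a b c d p r. \<exists>g\<in>G. affine_action x y z g a b c d p r) t"
  shows "polynomial_ring scale (invariants scale G)"
proof -
  interpret affine_group F n "\<lambda>a b c d p r. \<exists>g\<in>G. affine_action x y z g a b c d p r" t
    by (rule group)
  let ?e = "card U"
  define \<xi> where "\<xi> v = PU (x v) (z v)" for v
  define \<eta> where "\<eta> v = PU (y v) (z v)" for v
  define g2 where "g2 v = f2 \<kappa> (\<xi> v) (\<eta> v) (z v)" for v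
  define g3 where "g3 v = f3 \<kappa> (\<xi> v) (\<eta> v) (z v)" for v
  \<comment> \<open>The order matches the arguments of \<open>Q\<close> in the generation and
    independence results for the affine group.\<close>
  define f where "f i = (if i = 0 then z else if i = 1 then g2 else g3)" for i :: nat
  have sz: "degree_shift 1 z" by (rule degree_shift_linear[OF dual(3)])
  have sc: "degree_shift d (\<lambda>v. c * g v)" if "degree_shift d g" for d c g
    using degree_shift_mult[OF degree_shift_const that] by simp
  have sP: "degree_shift ?e (\<lambda>v. PU (l v) (z v))" if "l \<in> dual_space scale" for l
    using degree_shift_prod[OF finite_U, of 1 "\<lambda>u v. l v + u * z v"]
      degree_shift_add[OF degree_shift_linear[OF that] sc[OF sz]]
    by (simp add: PU_def)
  have sx: "degree_shift ?e \<xi>" and sy: "degree_shift ?e \<eta>"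
    unfolding \<xi>_def \<eta>_def by (rule sP[OF dual(1)], rule sP[OF dual(2)])
  have sze: "degree_shift ?e (\<lambda>v. z v ^ ?e)"
    using degree_shift_prod[of "{..<?e}" 1 "\<lambda>_. z"] sz by simp
  have sf: "degree_shift ?e (\<lambda>v. form \<kappa> ?e \<tau> (\<xi> v) (\<eta> v) (z v))" for \<tau>
    unfolding form_def by (intro degree_shift_add sc sx sy sze)
  have s2: "degree_shift (?e + ?e * card F) g2"
    unfolding g2_def f2_def by (intro degree_shift_mult sy degree_shift_prod finite_F sf)
  have s3: "degree_shift (?e * card T) g3"
    unfolding g3_def f3_def by (intro degree_shift_prod finite_T sf)
  have hom: "homogeneous scale (f i)" for i
    unfolding f_def using degree_shift_imp_homogeneous[OF sz] degree_shift_imp_homogeneous[OF s2]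
      degree_shift_imp_homogeneous[OF s3] by simp
  have "algebraically_independent 3 f"
  proof (rule algebraically_independentI)
    fix Q \<alpha> \<beta> \<gamma> assume Q: "polyfun Q" "\<And>v. Q (f 0 v) (f 1 v) (f 2 v) = 0"
    show "Q \<alpha> \<beta> \<gamma> = 0"
    proof (rule f2_f3_PU_independent[OF Q(1)])
      fix x' y' z'
      obtain v where "x v = x'" "y v = y'" "z v = z'" using surj by blast
      then show "Q z' (f2 \<kappa> (PU x' z') (PU y' z') z') (f3 \<kappa> (PU x' z') (PU y' z') z') = 0"
        using Q(2)[of v] by (simp add: f_def g2_def g3_def \<xi>_def \<eta>_def)
    qed
  qed
  moreover have "generated_algebra (f ` {..<3}) = invariants scale G"
  proof
    have inv_f: "f i (g v) = f i v" if g: "g \<in> G" for i g v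
    proof -
      obtain a b c d p r where act: "affine_action x y z g a b c d p r" using action[OF g] by blast
      then have A: "\<exists>g\<in>G. affine_action x y z g a b c d p r" using g by blast
      show ?thesis
        using act A_invariant[OF f2_inv A, of "x v" "y v" "z v"] A_invariant[OF f3_inv A, of "x v" "y v" "z v"]
        by (simp add: f_def g2_def g3_def \<xi>_def \<eta>_def affine_action_def)
    qed
    have xyz: "l \<in> sym_algebra scale" if "l \<in> dual_space scale" for l
      using that unfolding sym_algebra_def by (rule generated_algebra.incl)
    have pf: "(\<lambda>v. P (x v) (y v) (z v)) \<in> sym_algebra scale" if "polyfun P" for P
      using generated_algebra_polyfun[OF that] xyz[OF dual(1)] xyz[OF dual(2)] xyz[OF dual(3)]
      unfolding sym_algebra_def by blast
    have z3: "polyfun (\<lambda>x y z. z :: 'a)" by (rule wpol.thd) simp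
    have PUx: "polyfun (\<lambda>x y z. PU x z)" by (rule polyfun_PU)
    have PUy: "polyfun (\<lambda>x y z. PU y z)"
      by (rule polyfun_subst[OF polyfun_PU, of "\<lambda>x y z. y" "\<lambda>x y z. y" "\<lambda>x y z. z"])
        (simp_all add: wpol.snd z3)
    have f_sym: "f i \<in> sym_algebra scale" for i
    proof -
      have "g2 \<in> sym_algebra scale" unfolding g2_def[abs_def] \<xi>_def \<eta>_def
        by (rule pf[OF polyfun_subst[OF polyfun_f2 PUx PUy z3]])
      moreover have "g3 \<in> sym_algebra scale" unfolding g3_def[abs_def] \<xi>_def \<eta>_def
        by (rule pf[OF polyfun_subst[OF polyfun_f3 PUx PUy z3]])
      ultimately show ?thesis using xyz[OF dual(3)] by (simp add: f_def)
    qed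
    show "generated_algebra (f ` {..<3}) \<subseteq> invariants scale G"
    proof
      fix h assume h: "h \<in> generated_algebra (f ` {..<3})"
      have "h \<in> sym_algebra scale"
        using generated_algebra_subset[of "f ` {..<3}" "dual_space scale"] f_sym h
        unfolding sym_algebra_def by blast
      moreover have "h (g v) = h v" if "g \<in> G" for g v
        using h by induction (auto simp: inv_f[OF that])
      ultimately show "h \<in> invariants scale G"
        unfolding invariants_def using act_eq_iff[OF bij] by blast
    qed
    show "invariants scale G \<subseteq> generated_algebra (f ` {..<3})"
    proof
      fix h assume "h \<in> invariants scale G"
      then have h: "h \<in> sym_algebra scale" "\<And>g v. g \<in> G \<Longrightarrow> h (g v) = h v"
        unfolding invariants_def using act_eq_iff[OF bij] by blast+
      from h(1) have "\<exists>P. polyfun P \<and> (\<forall>v. h v = P (x v) (y v) (z v))"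
        unfolding sym_algebra_def
      proof induction
        case (const c)
        show ?case by (intro exI[of _ "\<lambda>x y z. c"]) (simp add: wpol.const)
      next
        case (incl l)
        then obtain \<alpha> \<beta> \<gamma> where "\<forall>v. l v = \<alpha> * x v + \<beta> * y v + \<gamma> * z v" using dual_gen by blast
        then show ?case
          by (intro exI[of _ "\<lambda>x y z. \<alpha> * x + \<beta> * y + \<gamma> * z"])
            (simp add: wpol.add wpol_scale wpol.fst wpol.snd wpol.thd)
      next
        case (add h1 h2)
        then obtain P1 P2 where "polyfun P1" "\<forall>v. h1 v = P1 (x v) (y v) (z v)"
          "polyfun P2" "\<forall>v. h2 v = P2 (x v) (y v) (z v)" by blast
        then show ?case
          by (intro exI[of _ "\<lambda>x y z. P1 x y z + P2 x y z"]) (simp add: wpol.add)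
      next
        case (mult h1 h2)
        then obtain P1 P2 where "polyfun P1" "\<forall>v. h1 v = P1 (x v) (y v) (z v)"
          "polyfun P2" "\<forall>v. h2 v = P2 (x v) (y v) (z v)" by blast
        then show ?case
          by (intro exI[of _ "\<lambda>x y z. P1 x y z * P2 x y z"]) (simp add: polyfun_mult)
      qed
      then obtain P where P: "polyfun P" "\<And>v. h v = P (x v) (y v) (z v)" by blast
      \<comment> \<open>Every triple of scalars is the coordinate vector of some \<open>v\<close>,
        so invariance of \<open>h\<close> becomes an identity for \<open>P\<close>.\<close>
      have "P (a * x' + b * y' + p * z') (c * x' + d * y' + r * z') z' = P x' y' z'"
        if A: "\<exists>g\<in>G. affine_action x y z g a b c d p r" for a b c d p r x' y' z'
      proof -
        obtain g where g: "g \<in> G" "affine_action x y z g a b c d p r" using A by blast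
        obtain v where "x v = x'" "y v = y'" "z v = z'" using surj by blast
        then show ?thesis using h(2)[OF g(1), of v] g(2) by (simp add: P(2) affine_action_def)
      qed
      from A_invariant_imp_generated[OF P(1) this] obtain Q where Q: "polyfun Q"
        "\<And>x y z. P x y z = Q z (f2 \<kappa> (PU x z) (PU y z) z) (f3 \<kappa> (PU x z) (PU y z) z)" by blast
      have "h = (\<lambda>v. Q (f 0 v) (f 1 v) (f 2 v))"
        by (rule ext) (simp add: P(2) Q(2) f_def g2_def g3_def \<xi>_def \<eta>_def)
      also have "\<dots> \<in> generated_algebra (f ` {..<3})"
        by (rule generated_algebra_polyfun[OF Q(1)]) (auto intro: generated_algebra.incl)
      finally show "h \<in> generated_algebra (f ` {..<3})" .
    qed
  qed
  ultimately show ?thesis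
    unfolding polynomial_ring_def Let_def dim using hom by blast
qed

text \<open>A generator acts on the quotient by the kernel of \<open>z\<close> as a scalar c with
  c^(2^r) = 1. In characteristic 2 this says (c + 1)^(2^r) = 0, hence c = 1.\<close>

lemma (in k_space) trivial_on_quotient:
  assumes char: "CHAR('a) = 2"
    and G: "subgroup G (GL scale)" "G = generate (GL scale) S"
    and S: "\<And>s. s \<in> S \<Longrightarrow> \<exists>r. group.ord (GL scale) s = 2 ^ r"
    and z: "z \<in> dual_space scale" "z e = 1" and ker: "\<And>g v. g \<in> G \<Longrightarrow> z v = 0 \<Longrightarrow> z (g v) = 0"
    and g: "g \<in> G"
  shows "z (g v) = z v"
proof -
  interpret GL: Group.group "GL scale" by (rule group_GL)
  have lin: "Vector_Spaces.linear scale scale s" if "s \<in> G" for s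
    using subgroup.subset[OF G(1)] that by (auto simp: GL_def)
  interpret z: Vector_Spaces.linear scale "(*)" z using z(1) by (simp add: dual_space_def)
  have S_fix: "z (s v) = z v" if sS: "s \<in> S" for s v
  proof -
    have s: "s \<in> G" using that G(2) generate.incl by metis
    interpret s: Vector_Spaces.linear scale scale s by (rule lin[OF s])
    let ?c = "z (s e)"
    have eig: "z (s v) = ?c * z v" for v
    proof -
      have "z (v - scale (z v) e) = 0" by (simp add: z.diff z.scale z(2))
      from ker[OF s this] show ?thesis by (simp add: s.diff s.scale z.diff z.scale)
    qed
    have pow: "z ((s [^]\<^bsub>GL scale\<^esub> m) e) = ?c ^ m" for m :: nat
    proof (induction m)
      case 0
      then show ?case by (simp add: nat_pow_def GL_def z(2))
    next
      case (Suc m)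
      have sm: "s [^]\<^bsub>GL scale\<^esub> Suc m = s \<circ> (s [^]\<^bsub>GL scale\<^esub> m)"
        using GL.nat_pow_Suc2[of s m] subgroup.subset[OF G(1)] s by (auto simp: GL_def)
      show ?case unfolding sm comp_apply by (subst eig) (simp add: Suc)
    qed
    from S[OF sS] obtain r where r: "group.ord (GL scale) s = 2 ^ r" ..
    have "s [^]\<^bsub>GL scale\<^esub> (2 ^ r :: nat) = \<one>\<^bsub>GL scale\<^esub>"
      using GL.pow_ord_eq_1[OF subsetD[OF subgroup.subset[OF G(1)] s]] unfolding r .
    then have "z (\<one>\<^bsub>GL scale\<^esub> e) = ?c ^ (2 ^ r)" using pow[of "2 ^ r"] by simp
    then have one: "?c ^ (2 ^ r) = 1" by (simp add: GL_def z(2))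
    have "(?c + 1) ^ (2 ^ r) = ?c ^ (2 ^ r) + 1 ^ (2 ^ r)"
      by (rule freshmans_dream'[of _ r]) (simp_all add: char)
    also have "\<dots> = 0" using minus_CHAR_2[OF char, of 1 1] by (simp add: one)
    finally have "?c = - 1" by (simp add: add_eq_0_iff2)
    then have "?c = 1" by (simp add: uminus_CHAR_2[OF char])
    then show ?thesis using eig[of v] by simp
  qed
  from g have "g \<in> generate (GL scale) S" using G(2) by simp
  then show ?thesis
  proof (induction arbitrary: v)
    case one
    then show ?case by (simp add: GL_def)
  next
    case (incl h)
    then show ?case by (rule S_fix)
  next
    case (inv h)
    have "h \<in> G" using generate.incl[OF inv, of "GL scale"] unfolding G(2)[symmetric] .
    then have h: "h \<in> carrier (GL scale)" by (rule subsetD[OF subgroup.subset[OF G(1)]])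
    define h' where "h' = inv\<^bsub>GL scale\<^esub> h"
    have "h \<circ> h' = id" using GL.r_inv[OF h] unfolding h'_def[symmetric] by (simp add: GL_def)
    then have "h (h' v) = v" by (metis comp_apply id_apply)
    then have "z (h' v) = z v" using S_fix[OF inv, of "h' v"] by simp
    then show ?case unfolding h'_def .
  next
    case (eng h1 h2)
    then show ?case by (simp add: GL_def)
  qed
qed

text \<open>Stated for any \<open>e\<close> outside the plane because it is used twice: for an
  arbitrary such vector, and then for one fixed by a torus element.\<close>

lemma (in k_space) SL2_frame:
  fixes b :: "2 \<Rightarrow> 'b"
  assumes char: "CHAR('a) = 2" and dim: "dim UNIV = 3"
    and G: "subgroup G (GL scale)" "G = generate (GL scale) S"
    and S: "\<And>s. s \<in> S \<Longrightarrow> \<exists>r. group.ord (GL scale) s = 2 ^ r"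
    and b: "inj b" "independent (range b)" and inv: "\<And>g. g \<in> G \<Longrightarrow> g ` span (range b) \<subseteq> span (range b)"
    and e: "e \<notin> span (range b)"
  obtains x y z where "x \<in> dual_space scale" "y \<in> dual_space scale" "z \<in> dual_space scale"
    and "\<And>v. v = scale (x v) (b 1) + scale (y v) (b 2) + scale (z v) e"
    and "x (b 1) = 1" "x (b 2) = 0" "x e = 0" "y (b 1) = 0" "y (b 2) = 1" "y e = 0"
    and "z (b 1) = 0" "z (b 2) = 0" "z e = 1"
    and "\<And>v. v \<in> span (range b) \<longleftrightarrow> z v = 0"
    and "\<And>g. g \<in> G \<Longrightarrow> affine_action x y z g
      (matrix_in_basis scale b g $ 1 $ 1) (matrix_in_basis scale b g $ 1 $ 2)
      (matrix_in_basis scale b g $ 2 $ 1) (matrix_in_basis scale b g $ 2 $ 2) (x (g e)) (y (g e))"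
proof -
  obtain x y z where d: "x \<in> dual_space scale" "y \<in> dual_space scale" "z \<in> dual_space scale"
    and rep: "\<And>v. v = scale (x v) (b 1) + scale (y v) (b 2) + scale (z v) e"
    and vals: "x (b 1) = 1" "x (b 2) = 0" "x e = 0" "y (b 1) = 0" "y (b 2) = 1" "y e = 0"
      "z (b 1) = 0" "z (b 2) = 0" "z e = 1"
    using coordinates[OF b e dim] by blast
  interpret x: Vector_Spaces.linear scale "(*)" x using d(1) by (simp add: dual_space_def)
  interpret y: Vector_Spaces.linear scale "(*)" y using d(2) by (simp add: dual_space_def)
  interpret z: Vector_Spaces.linear scale "(*)" z using d(3) by (simp add: dual_space_def)
  have bW: "b i \<in> span (range b)" for i by (simp add: span_base)
  have W: "v \<in> span (range b) \<longleftrightarrow> z v = 0" for v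
  proof
    assume v: "v \<in> span (range b)"
    show "z v = 0"
    proof (rule ccontr)
      assume nz: "z v \<noteq> 0"
      have "v - scale (x v) (b 1) - scale (y v) (b 2) \<in> span (range b)"
        by (intro span_diff span_scale bW v)
      moreover have "v - scale (x v) (b 1) - scale (y v) (b 2) = scale (z v) e"
        using rep[of v] by (metis add_diff_cancel_left' diff_diff_add)
      ultimately have "scale (inverse (z v)) (scale (z v) e) \<in> span (range b)"
        by (metis span_scale)
      then show False using nz e by simp
    qed
  next
    assume "z v = 0"
    then have "v = scale (x v) (b 1) + scale (y v) (b 2)" using rep[of v] by simp
    moreover have "scale (x v) (b 1) + scale (y v) (b 2) \<in> span (range b)"
      by (intro span_add span_scale bW)
    ultimately show "v \<in> span (range b)" by simp
  qed
  have zg: "z (g v) = z v" if "g \<in> G" for g v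
  proof (rule trivial_on_quotient[OF char G S d(3) vals(9) _ that])
    fix g v assume "g \<in> G" "z v = 0"
    then show "z (g v) = 0" using inv[of g] W by blast
  qed
  have "affine_action x y z g
      (matrix_in_basis scale b g $ 1 $ 1) (matrix_in_basis scale b g $ 1 $ 2)
      (matrix_in_basis scale b g $ 2 $ 1) (matrix_in_basis scale b g $ 2 $ 2) (x (g e)) (y (g e))"
    if g: "g \<in> G" for g
  proof -
    interpret g: Vector_Spaces.linear scale scale g
      using subsetD[OF subgroup.subset[OF G(1)] g] by (simp add: GL_def)
    have gb: "g (b j) = scale (x (g (b j))) (b 1) + scale (y (g (b j))) (b 2)" for j
    proof -
      have "z (g (b j)) = 0" using zg[OF g, of "b j"] W bW by simp
      then show ?thesis using rep[of "g (b j)"] by simp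
    qed
    have m: "matrix_in_basis scale b g $ 1 $ j = x (g (b j))" "matrix_in_basis scale b g $ 2 $ j = y (g (b j))" for j
      unfolding matrix_in_basis_def using representation_2[OF b, of "x (g (b j))" "y (g (b j))"]
      unfolding gb[symmetric] by simp_all
    have gv: "g v = scale (x v) (g (b 1)) + scale (y v) (g (b 2)) + scale (z v) (g e)" for v
      by (subst rep[of v]) (simp only: g.add g.scale)
    show ?thesis
      unfolding affine_action_def m
    proof (intro allI conjI)
      fix v
      show "x (g v) = x (g (b 1)) * x v + x (g (b 2)) * y v + x (g e) * z v"
        by (subst gv[of v]) (simp add: x.add x.scale mult.commute)
      show "y (g v) = y (g (b 1)) * x v + y (g (b 2)) * y v + y (g e) * z v"
        by (subst gv[of v]) (simp add: y.add y.scale mult.commute)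
      show "z (g v) = z v" by (rule zg[OF g])
    qed
  qed
  with d rep vals W show ?thesis by (rule that)
qed

theorem theorem1p3:
  fixes smul :: "'k::alg_closed_field \<Rightarrow> 'v::ab_group_add \<Rightarrow> 'v"
    and n :: nat and F :: "'k set" and G S :: "('v \<Rightarrow> 'v) set" and W :: "'v set"
  assumes "CHAR('k) = 2"
    and "vector_space smul" and "vector_space.dim smul (UNIV :: 'v set) = 3"
    and "n > 1" and "subfield F (ring_of_type_algebra :: 'k ring)" and "card F = 2 ^ n"
    and "subgroup G (GL smul)" and "finite G"
    and "G = generate (GL smul) S"
    and "\<forall>s\<in>S. pseudoreflection smul s \<and>
           (\<exists>r\<ge>1. group.ord (GL smul) s = 2 ^ r)"
    and "module.subspace smul W" and "vector_space.dim smul W = 2" and "\<forall>g\<in>G. g ` W \<subseteq> W"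
    and "restricts_to_SL2 smul G W F"
  shows "polynomial_ring smul (invariants smul G)"
proof -
  interpret k_space smul by (simp add: k_space_def assms(2))
  have base: "char2_subfield F n 1" by (rule char2_subfieldI[OF assms(1,4-6)])
  interpret base: char2_subfield F n 1 by (rule base)
  obtain b :: "2 \<Rightarrow> 'v" where b: "inj b" "independent (range b)" "span (range b) = W"
    "matrix_in_basis smul b ` G = SL F"
    using assms(14) unfolding restricts_to_SL2_def by blast
  have S: "\<exists>r. group.ord (GL smul) s = 2 ^ r" if "s \<in> S" for s
    using bspec[OF assms(10) that] by blast
  have inv: "g ` span (range b) \<subseteq> span (range b)" if "g \<in> G" for g
    using bspec[OF assms(13) that] unfolding b(3) .
  have M: "\<exists>g\<in>G. matrix_in_basis smul b g $ 1 $ 1 = p \<and> matrix_in_basis smul b g $ 1 $ 2 = q \<and>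
      matrix_in_basis smul b g $ 2 $ 1 = r \<and> matrix_in_basis smul b g $ 2 $ 2 = s"
    if "p \<in> F" "q \<in> F" "r \<in> F" "s \<in> F" "p * s - q * r = 1" for p q r s
  proof -
    define m :: "'k ^ 2 ^ 2" where
      "m = (\<chi> i j. if i = 1 then if j = 1 then p else q else if j = 1 then r else s)"
    have m: "m $ 1 $ 1 = p" "m $ 1 $ 2 = q" "m $ 2 $ 1 = r" "m $ 2 $ 2 = s" by (simp_all add: m_def)
    have "m \<in> SL F" using that by (simp add: SL_def det_2 m) (simp add: m_def)
    then obtain g where "g \<in> G" "m = matrix_in_basis smul b g" unfolding b(4)[symmetric] by blast
    then show ?thesis using m by blast
  qed
  have M_SL: "matrix_in_basis smul b g \<in> SL F" if "g \<in> G" for g using b(4) that by blast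
  \<comment> \<open>As \<open>n > 1\<close>, \<open>F\<close> is larger than {0, 1}; for such
    \<open>t\<close> the matrix diag(t, 1/t) does not have the eigenvalue 1.\<close>
  obtain t where t: "t \<in> F" "t \<noteq> 0" "t \<noteq> 1"
  proof -
    have "(2::nat) ^ 1 < 2 ^ n" using assms(4) by (intro power_strict_increasing) auto
    then have "card {0, 1 :: 'k} < card F" using assms(6) by simp
    then have "\<not> F \<subseteq> {0, 1}" using card_mono[of "{0, 1 :: 'k}" F] by auto
    then show ?thesis using that by blast
  qed
  obtain g0 where g0: "g0 \<in> G" "matrix_in_basis smul b g0 $ 1 $ 1 = t" "matrix_in_basis smul b g0 $ 1 $ 2 = 0"
    "matrix_in_basis smul b g0 $ 2 $ 1 = 0" "matrix_in_basis smul b g0 $ 2 $ 2 = inverse t"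
    using M[of t 0 0 "inverse t"] t base.F_0 base.F_inverse by auto
  text \<open>As \<open>g0\<close> has no eigenvalue \<open>1\<close> on \<open>W\<close>, it fixes a vector outside \<open>W\<close>; taking it as the
    third basis vector normalises the cocycle on the torus.\<close>
  obtain e where e: "e \<notin> span (range b)" "g0 e = e"
  proof -
    have "span (range b) \<noteq> UNIV" using assms(3,12) b(3) by auto
    then obtain e0 where e0: "e0 \<notin> span (range b)" by auto
    obtain x y z where d: "x \<in> dual_space smul" "y \<in> dual_space smul" "z \<in> dual_space smul"
      and rep: "\<And>v. v = smul (x v) (b 1) + smul (y v) (b 2) + smul (z v) e0"
      and vals: "x (b 1) = 1" "x (b 2) = 0" "x e0 = 0" "y (b 1) = 0" "y (b 2) = 1" "y e0 = 0"
        "z (b 1) = 0" "z (b 2) = 0" "z e0 = 1"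
      and W: "\<And>v. v \<in> span (range b) \<longleftrightarrow> z v = 0"
      and act: "\<And>g. g \<in> G \<Longrightarrow> affine_action x y z g
        (matrix_in_basis smul b g $ 1 $ 1) (matrix_in_basis smul b g $ 1 $ 2)
        (matrix_in_basis smul b g $ 2 $ 1) (matrix_in_basis smul b g $ 2 $ 2) (x (g e0)) (y (g e0))"
      by (rule SL2_frame[OF assms(1,3,7,9) S b(1,2) inv e0 that])
    interpret x: Vector_Spaces.linear smul "(*)" x using d(1) by (simp add: dual_space_def)
    interpret y: Vector_Spaces.linear smul "(*)" y using d(2) by (simp add: dual_space_def)
    interpret z: Vector_Spaces.linear smul "(*)" z using d(3) by (simp add: dual_space_def)
    \<comment> \<open>\<open>p\<close> and \<open>r\<close> solve
      \<open>t * p + x (g0 e0) = p\<close> and \<open>inverse t * r + y (g0 e0) = r\<close>, the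
      equations for \<open>g0\<close> to fix \<open>e\<close>.\<close>
    define p where "p = x (g0 e0) / (1 - t)"
    define r where "r = y (g0 e0) / (1 - inverse t)"
    define e where "e = e0 + smul p (b 1) + smul r (b 2)"
    have xe: "x e = p" and ye: "y e = r" and ze: "z e = 1"
      by (simp_all add: e_def x.add x.scale y.add y.scale z.add z.scale vals)
    have t1: "1 - t \<noteq> 0" "1 - inverse t \<noteq> 0" using t by (auto simp: field_simps)
    have "t * p + x (g0 e0) = p" using t1 by (simp add: p_def field_simps)
    moreover have "inverse t * r + y (g0 e0) = r"
    proof -
      have "y (g0 e0) = r * (1 - inverse t)" using t1 by (simp add: r_def)
      then show ?thesis by (simp add: algebra_simps)
    qed
    ultimately have coords: "x (g0 e) = x e" "y (g0 e) = y e" "z (g0 e) = z e"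
      using act[OF g0(1), unfolded affine_action_def, rule_format, of e]
      by (simp_all add: g0(2-) xe ye ze)
    have "g0 e = smul (x (g0 e)) (b 1) + smul (y (g0 e)) (b 2) + smul (z (g0 e)) e0" by (rule rep)
    also have "\<dots> = e" unfolding coords by (rule rep[symmetric])
    finally have "g0 e = e" .
    moreover have "e \<notin> span (range b)" using W ze by simp
    ultimately show ?thesis using that by blast
  qed
  obtain x y z where d: "x \<in> dual_space smul" "y \<in> dual_space smul" "z \<in> dual_space smul"
    and rep: "\<And>v. v = smul (x v) (b 1) + smul (y v) (b 2) + smul (z v) e"
    and vals: "x (b 1) = 1" "x (b 2) = 0" "x e = 0" "y (b 1) = 0" "y (b 2) = 1" "y e = 0"
      "z (b 1) = 0" "z (b 2) = 0" "z e = 1"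
    and W: "\<And>v. v \<in> span (range b) \<longleftrightarrow> z v = 0"
    and act: "\<And>g. g \<in> G \<Longrightarrow> affine_action x y z g
      (matrix_in_basis smul b g $ 1 $ 1) (matrix_in_basis smul b g $ 1 $ 2)
      (matrix_in_basis smul b g $ 2 $ 1) (matrix_in_basis smul b g $ 2 $ 2) (x (g e)) (y (g e))"
    by (rule SL2_frame[OF assms(1,3,7,9) S b(1,2) inv e(1) that])
  interpret x: Vector_Spaces.linear smul "(*)" x using d(1) by (simp add: dual_space_def)
  interpret y: Vector_Spaces.linear smul "(*)" y using d(2) by (simp add: dual_space_def)
  interpret z: Vector_Spaces.linear smul "(*)" z using d(3) by (simp add: dual_space_def)
  \<comment> \<open>Evaluating at the basis vectors shows that \<open>g\<close> determines its
    coefficients. So they are the entries of its matrix, and the finite group \<open>G\<close>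
    contains only finitely many translations.\<close>
  have coeffs: "a1 = x (g (b 1))" "a2 = x (g (b 2))" "a3 = y (g (b 1))" "a4 = y (g (b 2))" "p = x (g e)" "r = y (g e)"
    if "affine_action x y z g a1 a2 a3 a4 p r" for g a1 a2 a3 a4 p r
    using that unfolding affine_action_def by (simp_all add: vals)
  show ?thesis
  proof (rule polynomial_ring_invariants[OF assms(3) d, of G F n t])
    fix l assume "l \<in> dual_space smul"
    then interpret l: Vector_Spaces.linear smul "(*)" l by (simp add: dual_space_def)
    have "l v = l (b 1) * x v + l (b 2) * y v + l e * z v" for v
      by (subst rep[of v]) (simp add: l.add l.scale mult.commute)
    then show "\<exists>\<alpha> \<beta> \<gamma>. \<forall>v. l v = \<alpha> * x v + \<beta> * y v + \<gamma> * z v" by blast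
  next
    fix \<alpha> \<beta> \<gamma>
    show "\<exists>v. x v = \<alpha> \<and> y v = \<beta> \<and> z v = \<gamma>"
      by (rule exI[of _ "smul \<alpha> (b 1) + smul \<beta> (b 2) + smul \<gamma> e"])
        (simp add: x.add x.scale y.add y.scale z.add z.scale vals)
  next
    fix g assume "g \<in> G"
    then show "bij g" using subgroup.subset[OF assms(7)] by (auto simp: GL_def)
  next
    fix g assume "g \<in> G"
    then show "\<exists>a b c d p r. affine_action x y z g a b c d p r" using act by blast
  next
    show "affine_group F n (\<lambda>a b c d p r. \<exists>g\<in>G. affine_action x y z g a b c d p r) t"
    proof (rule affine_group.intro)
      show "char2_subfield F n 1" by (rule base)
      have "id \<in> G" using subgroup.one_closed[OF assms(7)] by (simp add: GL_def)
      then show "\<exists>g\<in>G. affine_action x y z g 1 0 0 1 0 0"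
        by (intro bexI[of _ id]) (simp_all add: affine_action_def)
    next
      fix a b c d p r a' b' c' d' p' r'
      assume "\<exists>g\<in>G. affine_action x y z g a b c d p r" "\<exists>g\<in>G. affine_action x y z g a' b' c' d' p' r'"
      then obtain g h where gh: "g \<in> G" "affine_action x y z g a b c d p r"
        "h \<in> G" "affine_action x y z h a' b' c' d' p' r'" by blast
      have "g \<circ> h \<in> G" using subgroup.m_closed[OF assms(7) gh(1,3)] by (simp add: GL_def)
      then show "\<exists>g\<in>G. affine_action x y z g (a * a' + b * c') (a * b' + b * d') (c * a' + d * c') (c * b' + d * d')
        (a * p' + b * r' + p) (c * p' + d * r' + r)"
        using affine_action_comp[OF gh(2,4)] by blast
    next
      fix a1 a2 a3 a4 p r
      assume "\<exists>g\<in>G. affine_action x y z g a1 a2 a3 a4 p r"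
      then obtain g where g: "g \<in> G" "affine_action x y z g a1 a2 a3 a4 p r" by blast
      show "a1 \<in> F \<and> a2 \<in> F \<and> a3 \<in> F \<and> a4 \<in> F \<and> a1 * a4 - a2 * a3 = 1"
        unfolding coeffs(1-4)[OF g(2)] coeffs(1-4)[OF act[OF g(1)], symmetric]
        using M_SL[OF g(1)] by (auto simp: SL_def det_2)
    next
      fix a1 a2 a3 a4 assume "a1 \<in> F" "a2 \<in> F" "a3 \<in> F" "a4 \<in> F" "a1 * a4 - a2 * a3 = 1"
      from M[OF this] show "\<exists>p r. \<exists>g\<in>G. affine_action x y z g a1 a2 a3 a4 p r"
        using act by metis
    next
      have "{(p, r). \<exists>g\<in>G. affine_action x y z g 1 0 0 1 p r} \<subseteq> (\<lambda>g. (x (g e), y (g e))) ` G"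
        using coeffs(5,6) by blast
      then show "finite {(p, r). \<exists>g\<in>G. affine_action x y z g 1 0 0 1 p r}"
        by (rule finite_subset) (simp add: assms(8))
    next
      show "t \<in> F" "t \<noteq> 0" "t \<noteq> 1" by (rule t)+
      \<comment> \<open>Since \<open>g0\<close> fixes the third basis vector \<open>e\<close>, its
        translation part is \<open>(x e, y e) = (0, 0)\<close>.\<close>
      show "\<exists>g\<in>G. affine_action x y z g t 0 0 (inverse t) 0 0"
        using act[OF g0(1)] g0 by (auto simp: e(2) vals)
    qed
  qed
qed

end
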